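(* Let $d \geq 3$ and $k \geq 2$ be integers, let $s = \lfloor d/(2k) \rfloor$, and let $r = d - 2sk$, so that $d = 2sk + r$ with $0 \leq r < 2k$. Let \[ F(x,t) \coloneqq \tfrac12 h(tx) + h\big((1-t)x\big) + \tfrac12 h\big(1-(2-t)x\big) - H(x), \qquad F_d(x,t) \coloneqq d\cdot F(x,t) + H(x). \] If \[ F_d(x_0,t_0) < 0 \quad \text{for } x_0 = \frac{r}{2k} \text{ and } t_0 = \frac{d-2k+r}{d}, \] then $\mathbb{G}_{N,d}$ a.a.s. (as $N \to \infty$ with $Nd/(2k) \in \mathbb{N}$) has the following property: for every partition $A_s \sqcup A_{s+1} = \{1,\ldots,N\}$ with $|A_{s+1}| = rN/(2k)$ there exists a $k$-star decomposition with exactly $j$ stars centered at each vertex of $A_j$, for $j = s, s+1$.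
   Context: $h(x) = -x\log x$ for $x \in (0,1]$ and $h(0) = 0$; $H(x) = h(x) + h(1-x)$; $\log$ is the natural logarithm. $\mathbb{G}_{N,d}$ is the random $d$-regular multigraph given by the configuration model: each of $N$ vertices receives $d$ half-edges, and a uniformly random perfect matching of the $Nd$ half-edges produces $Nd/2$ edges (loops and multiple edges allowed). A $k$-star is a set of $k$ edges sharing a common vertex (its center); a $k$-star decomposition is a partition of the edge set into $k$-stars, each with a designated center.
   Formalization: The formal statement assumes 2k ≤ d (s ≥ 1). For s = 0 the claim as printed fails whenever its hypothesis holds (e.g. d = k = 3: F_d(1/2,0) < 0, but every A_0 of size N/2 would have to be independent), and for d < k the quantity F_d(x_0,t_0) is undefined. *)

theory Defs
  imports "HOL-Probability.Probability" "HOL-Library.Disjoint_Sets"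
begin

section \<open>Entropy functions\<close>

text \<open>
  \<open>h\<close> and \<open>H\<close> are only meant for arguments in the unit interval; outside of it, the values
  below are junk. In the theorem, every argument of \<open>ent\<close> and \<open>ent2\<close> lies in \<open>[0, 1]\<close>
  because \<open>2 * k \<le> d\<close>. That assumption is the case \<open>s \<ge> 1\<close>: for \<open>s = 0\<close> the conclusion would make
  every \<open>A\<^sub>0\<close> of linear size independent, which fails for every graph once \<open>A\<^sub>0\<close> contains both ends
  of an edge, while the hypothesis on \<open>F\<^sub>d\<close> can hold (e.g. \<open>d = k = 3\<close>).
\<close>

definition ent :: "real \<Rightarrow> real"  (* h *)
  where "ent x = (if x = 0 then 0 else - x * ln x)"

definition ent2 :: "real \<Rightarrow> real"  (* H *)
  where "ent2 x = ent x + ent (1 - x)"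

definition rate_F :: "real \<Rightarrow> real \<Rightarrow> real"  (* F *)
  where "rate_F x t =
    1/2 * ent (t * x) + ent ((1 - t) * x) + 1/2 * ent (1 - (2 - t) * x) - ent2 x"

definition rate_Fd :: "nat \<Rightarrow> real \<Rightarrow> real \<Rightarrow> real"  (* F_d *)
  where "rate_Fd d x t = real d * rate_F x t + ent2 x"


section \<open>Star decompositions of multigraphs\<close>

text \<open>
  A multigraph is given by a set \<open>E\<close> of edges and a function \<open>ends\<close> sending an edge to its set of
  end vertices (a singleton for a loop). In particular, parallel edges are distinct
  elements of \<open>E\<close>, and a star may contain parallel edges and loops at its center, each
  counting as one edge.
\<close>

definition k_star :: "('e \<Rightarrow> 'v set) \<Rightarrow> nat \<Rightarrow> 'v \<Rightarrow> 'e set \<Rightarrow> bool"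
  where "k_star ends k v S \<longleftrightarrow> finite S \<and> card S = k \<and> (\<forall>e\<in>S. v \<in> ends e)"

text \<open>The function \<open>c\<close> designates the center of each star of the decomposition \<open>P\<close>.\<close>

definition k_star_decomposition ::
    "'e set \<Rightarrow> ('e \<Rightarrow> 'v set) \<Rightarrow> nat \<Rightarrow> 'e set set \<Rightarrow> ('e set \<Rightarrow> 'v) \<Rightarrow> bool"
  where "k_star_decomposition E ends k P c \<longleftrightarrow>
    partition_on E P \<and> (\<forall>S\<in>P. k_star ends k (c S) S)"


section \<open>The configuration model\<close>

text \<open>The half-edge \<open>(v, i)\<close> is the \<open>i\<close>-th half-edge at the vertex \<open>v\<close>.\<close>

definition half_edges :: "nat \<Rightarrow> nat \<Rightarrow> (nat \<times> nat) set"
  where "half_edges N d = {1..N} \<times> {1..d}"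

definition perfect_matchings :: "'a set \<Rightarrow> 'a set set set"
  where "perfect_matchings A = {M. partition_on A M \<and> (\<forall>e\<in>M. card e = 2)}"

lemma finite_perfect_matchings:
  assumes "finite A"
  shows "finite (perfect_matchings A)"
  using finitely_many_partition_on[OF assms]
  by (rule finite_subset[rotated]) (auto simp: perfect_matchings_def)

lemma perfect_matchings_nonempty:
  assumes "finite A" and "even (card A)"
  shows "perfect_matchings A \<noteq> {}"
  using assms
proof (induction "card A" arbitrary: A rule: less_induct)
  case less
  show ?case
  proof (cases "A = {}")
    case True
    then show ?thesis
      by (auto simp: perfect_matchings_def partition_on_def intro!: exI[of _ "{}"])
  next
    case False
    with less.prems have "card A \<ge> 2"
      by (metis One_nat_def Suc_1 card_eq_0_iff not_less_eq_eq le_Suc_eq le_zero_eq odd_one)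
    then obtain B where B: "B \<subseteq> A" "card B = 2"
      by (meson obtain_subset_with_card_n)
    then have "finite B"
      using less.prems finite_subset by blast
    with B less.prems have "card (A - B) = card A - 2"
      by (simp add: card_Diff_subset)
    with less \<open>card A \<ge> 2\<close> have "perfect_matchings (A - B) \<noteq> {}"
      by (intro less.hyps) auto
    then obtain M where M: "partition_on (A - B) M" "\<forall>e\<in>M. card e = 2"
      by (auto simp: perfect_matchings_def)
    have "partition_on A (insert B M)"
      using B M(1)
      by (subst partition_on_insert) (auto simp: disjnt_def partition_on_def)
    with M B show ?thesis
      by (auto simp: perfect_matchings_def)
  qed
qed

text \<open>
  The edges of the random multigraph are the pairs of the random matching. The set over which
  the distribution is uniform is finite, and it is nonempty whenever \<open>N * d\<close> is even.
\<close>

definition configuration_model :: "nat \<Rightarrow> nat \<Rightarrow> (nat \<times> nat) set set pmf"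
  where "configuration_model N d = pmf_of_set (perfect_matchings (half_edges N d))"

definition config_ends :: "(nat \<times> nat) set \<Rightarrow> nat set"
  where "config_ends e = fst ` e"

end

theory Submission
  imports Defs "HOL-Real_Asymp.Real_Asymp"
begin

text \<open>
  By Hall's theorem, a decomposition with \<open>j(v)\<close> stars at each vertex \<open>v\<close> exists as soon as every
  vertex set \<open>U\<close> spans at most \<open>k\<close> times the sum of \<open>j\<close> over \<open>U\<close> edges. For \<open>|U| \<le> |A\<^sub>s|\<close> this follows
  if \<open>U\<close> spans at most \<open>k s |U|\<close> edges; for larger \<open>U\<close>, it is a bound on the number of edges
  spanned by the complement, a set of size at most \<open>x\<^sub>0 N\<close>. So it suffices that a.a.s. no set of
  size at most \<open>x\<^sub>0 N\<close> has a fraction \<open>t\<^sub>0\<close> of its half-edges matched internally, and likewise for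
  \<open>1 - x\<^sub>0\<close> and \<open>t\<^sub>1 = 1 - r/d\<close>; passing to complements exchanges the two threshold pairs.

  The expected number of bad sets of size \<open>x N\<close> is at most \<open>exp (N F\<^sub>d(x, t))\<close> up to a factor
  polynomial in \<open>x N\<close>. The sign of the second derivative of \<open>F\<^sub>d(\<cdot>, t)\<close> is that of
  a decreasing linear function, while \<open>F\<^sub>d(0, t) = 0\<close> and \<open>F\<^sub>d(t, t) = H(t) > 0\<close>; hence
  negativity at \<open>x\<^sub>0 < t\<close> propagates to all of \<open>(0, x\<^sub>0]\<close>, in the form
  \<open>F\<^sub>d(x, t) \<le> x (\<delta> ln x - c)\<close>, and the union bound is \<open>O(N\<^sup>-\<^sup>\<delta>)\<close>.
\<close>

section \<open>The rate function\<close>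

lemma ent_eq: "ent x = - x * ln x"
  by (simp add: ent_def)

lemma ent_nonneg: "0 \<le> x \<Longrightarrow> x \<le> 1 \<Longrightarrow> ent x \<ge> 0"
  by (cases "x = 0") (auto simp: ent_eq intro!: mult_nonneg_nonpos)

lemma ent_mult: "0 < a \<Longrightarrow> 0 < x \<Longrightarrow> ent (a * x) = a * ent x + x * ent a"
  by (simp add: ent_eq ln_mult algebra_simps)

lemma ent_one_minus_le:
  assumes "0 \<le> y" "y \<le> 1"
  shows "ent (1 - y) \<le> y"
proof (cases "y = 1")
  case False
  with assms have y: "1 - y > 0" by simp
  have "- ln (1 - y) = ln (1 / (1 - y))" using y by (simp add: ln_div)
  also have "\<dots> \<le> 1 / (1 - y) - 1" using y by (intro ln_le_minus_one) simp
  finally have "(1 - y) * (- ln (1 - y)) \<le> (1 - y) * (1 / (1 - y) - 1)"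
    using y by (intro mult_left_mono) auto
  also have "\<dots> = y" using y by (simp add: field_simps)
  finally show ?thesis by (simp add: ent_eq algebra_simps)
qed (simp add: ent_def)

lemma ent_has_real_derivative:
  "x > 0 \<Longrightarrow> (ent has_real_derivative (- ln x - 1)) (at x)"
  unfolding ent_eq[abs_def] by (auto intro!: derivative_eq_intros)

lemma continuous_on_ent: "continuous_on {0..} ent"
  unfolding continuous_on_def
proof
  fix x :: real
  assume x: "x \<in> {0..}"
  show "(ent \<longlongrightarrow> ent x) (at x within {0..})"
  proof (cases "x = 0")
    case True
    have "((\<lambda>x::real. - x * ln x) \<longlongrightarrow> 0) (at_right 0)"
      by real_asymp
    then show ?thesis
      using True by (simp add: ent_eq[abs_def] at_within_Ici_at_right)
  next
    case False
    with x have "isCont ent x"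
      by (intro DERIV_isCont[OF ent_has_real_derivative]) simp
    then show ?thesis
      by (auto simp: isCont_def intro: tendsto_within_subset)
  qed
qed

lemma rate_Fd_eq:
  "rate_Fd d x t = real d * (1/2 * ent (t * x) + ent ((1 - t) * x) + 1/2 * ent (1 - (2 - t) * x))
     - (real d - 1) * (ent x + ent (1 - x))"
  by (simp add: rate_Fd_def rate_F_def ent2_def algebra_simps)

text \<open>The identity (2 - t) t = 1 - (1 - t)^2 keeps the third entropy argument of
  \<open>rate_F\<close> positive for all x \<le> t, so its logarithm can be differentiated
  there.\<close>

lemma two_minus_mult_less_one:
  fixes x t :: real
  assumes "x \<le> t" "t < 1"
  shows "(2 - t) * x < 1"
proof -
  have "(2 - t) * x \<le> (2 - t) * t" using assms by (intro mult_left_mono) auto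
  also have "\<dots> = 1 - (1 - t)\<^sup>2" by (simp add: power2_eq_square algebra_simps)
  also have "\<dots> < 1" using assms by simp
  finally show ?thesis .
qed

lemma continuous_on_rate_Fd:
  assumes "0 < t" "t < 1"
  shows "continuous_on {0..t} (\<lambda>x. rate_Fd d x t)"
proof -
  have [simp]: "(2 - t) * x \<le> 1" if "x \<le> t" for x
    using two_minus_mult_less_one[of x t] assms that by simp
  show ?thesis
    unfolding rate_Fd_eq using assms
    by (intro continuous_intros continuous_on_compose2[OF continuous_on_ent]) auto
qed

lemma rate_Fd_0: "rate_Fd d 0 t = 0"
  by (simp add: rate_Fd_eq ent_def)

text \<open>At x = t the weights t^2, 2 t (1 - t), (1 - t)^2 are those of two independent ends. The
  ordered pair of ends then has entropy 2 H(t), half of which cancels H(t) in F; only the added H(t)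
  remains.\<close>

lemma rate_Fd_diagonal: "rate_Fd d t t = ent2 t" if "0 < t" "t < 1"
proof -
  have *: "1 - (2 - t) * t = (1 - t)\<^sup>2" by (simp add: power2_eq_square algebra_simps)
  have "ln (t * t) = ln t + ln t" "ln ((1 - t) * t) = ln (1 - t) + ln t"
    "ln ((1 - t)\<^sup>2) = 2 * ln (1 - t)"
    using that by (simp_all add: ln_mult ln_realpow)
  then have "rate_F t t = 0"
    unfolding rate_F_def * ent2_def ent_eq by (simp add: field_simps power2_eq_square)
  then show ?thesis by (simp add: rate_Fd_def)
qed

lemma ent_pos: "0 < x \<Longrightarrow> x < 1 \<Longrightarrow> ent x > 0"
  by (simp add: ent_eq mult_pos_neg)

lemma ent2_pos: "0 < x \<Longrightarrow> x < 1 \<Longrightarrow> ent2 x > 0"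
  by (simp add: ent2_def ent_pos add_pos_pos)

section \<open>First and second derivatives in x\<close>

definition rate_Fd' :: "nat \<Rightarrow> real \<Rightarrow> real \<Rightarrow> real" where
  "rate_Fd' d t x = real d * (- t/2 * ln (t * x) - (1 - t) * ln ((1 - t) * x)
     + (2 - t)/2 * ln (1 - (2 - t) * x)) + (real d - 1) * (ln x - ln (1 - x))"

text \<open>The constants from (- y ln y)' = - ln y - 1 cancel because t/2 + (1 - t) = (2 - t)/2,
  which leaves only logarithms.\<close>

lemma rate_Fd_has_derivative:
  assumes "0 < x" "x \<le> t" "t < 1"
  shows "((\<lambda>x. rate_Fd d x t) has_real_derivative rate_Fd' d t x) (at x)"
proof -
  have "(2 - t) * x < 1" using assms two_minus_mult_less_one by simp
  then show ?thesis
    unfolding rate_Fd_eq rate_Fd'_def using assms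
    by (auto intro!: derivative_eq_intros DERIV_chain2[where f = ent, OF ent_has_real_derivative]
        simp: algebra_simps add_divide_distrib diff_divide_distrib)
qed

lemma rate_Fd'_has_derivative:
  assumes "0 < x" "x \<le> t" "t < 1"
  shows "(rate_Fd' d t has_real_derivative
     ((real d * t / 2 - 1) - (2 - t) * (real d / 2 - 1) * x) / (x * (1 - x) * (1 - (2 - t) * x))) (at x)"
proof -
  have *: "(2 - t) * x < 1" using assms two_minus_mult_less_one by simp
  define u where "u = 1 - (2 - t) * x"
  have u: "u > 0" using * by (simp add: u_def)
  have "(rate_Fd' d t has_real_derivative
     (real d * (- t/2 / x - (1 - t) / x - (2 - t)\<^sup>2/2 / u) + (real d - 1) * (1 / x + 1 / (1 - x)))) (at x)"
  proof -
    have L: "(ln has_real_derivative 1 / x) (at x)"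
      "((\<lambda>x. ln (t * x)) has_real_derivative 1 / x) (at x)"
      "((\<lambda>x. ln ((1 - t) * x)) has_real_derivative 1 / x) (at x)"
      "((\<lambda>x. ln (1 - x)) has_real_derivative - 1 / (1 - x)) (at x)"
      "((\<lambda>x. ln (1 - (2 - t) * x)) has_real_derivative - (2 - t) / u) (at x)"
      using assms * by (auto intro!: derivative_eq_intros simp: u_def)
    have sq: "(2 - t) * (t - 2) = - ((2 - t) * (2 - t))" by (simp add: algebra_simps)
    show ?thesis
      unfolding rate_Fd'_def
      by (rule DERIV_cong[OF DERIV_add[OF DERIV_cmult[OF DERIV_add[OF DERIV_diff[OF DERIV_cmult[OF L(2)]
            DERIV_cmult[OF L(3)]] DERIV_cmult[OF L(5)]]] DERIV_cmult[OF DERIV_diff[OF L(1,4)]]]])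
        (simp add: power2_eq_square sq)
  qed
  moreover have "real d * (- t/2 / x - (1 - t) / x - (2 - t)\<^sup>2/2 / u) + (real d - 1) * (1 / x + 1 / (1 - x))
    = ((real d * t / 2 - 1) - (2 - t) * (real d / 2 - 1) * x) / (x * (1 - x) * u)"
  proof -
    have "real d * (- t/2 / x - (1 - t) / x - (2 - t)\<^sup>2/2 / u) + (real d - 1) * (1 / x + 1 / (1 - x))
      = (real d * (- t/2 * (1-x)*u - (1 - t) *(1-x)*u - (2 - t)\<^sup>2/2 *x*(1-x)) + (real d - 1) * u) / (x * (1 - x) * u)"
      using assms u by (simp add: divide_simps) (simp add: algebra_simps)
    \<comment> \<open>The quadratic terms in x cancel; the sign argument rests on this linear
      numerator.\<close>
    also have "real d * (- t/2 * (1-x)*u - (1 - t) *(1-x)*u - (2 - t)\<^sup>2/2 *x*(1-x)) + (real d - 1) * u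
       = (real d * t / 2 - 1) - (2 - t) * (real d / 2 - 1) * x"
      unfolding u_def by (simp add: field_simps power2_eq_square)
    finally show ?thesis .
  qed
  ultimately show ?thesis by (simp add: u_def)
qed

text \<open>Only continuity is asked for at the ends because the left end may be 0, where the
  derivative formula involves ln x.\<close>

lemma MVT_continuous_on:
  fixes f f' :: "real \<Rightarrow> real"
  assumes "a < b" "continuous_on {a..b} f"
    and "\<And>x. a < x \<Longrightarrow> x < b \<Longrightarrow> (f has_real_derivative f' x) (at x)"
  obtains z where "a < z" "z < b" "f b - f a = (b - a) * f' z"
proof -
  obtain l z where z: "a < z" "z < b" "DERIV f z :> l" "f b - f a = (b - a) * l"
    using MVT[OF assms(1,2)] assms(3) real_differentiable_def by blast
  moreover have "l = f' z" using z assms(3) DERIV_unique by blast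
  ultimately show ?thesis using that by blast
qed

lemma rate_Fd_mean_value:
  assumes "0 \<le> a" "a < b" "b \<le> t" "t < 1"
  obtains z where "a < z" "z < b" "rate_Fd d b t - rate_Fd d a t = (b - a) * rate_Fd' d t z"
proof (rule MVT_continuous_on[of a b "\<lambda>x. rate_Fd d x t" "rate_Fd' d t"])
  show "continuous_on {a..b} (\<lambda>x. rate_Fd d x t)"
    using assms by (intro continuous_on_subset[OF continuous_on_rate_Fd]) auto
qed (use assms that in \<open>auto intro: rate_Fd_has_derivative\<close>)

text \<open>The denominator of the second derivative is positive, so comparing
  \<open>rate_Fd'\<close> at two points reveals the sign of the linear numerator somewhere between
  them.\<close>

lemma rate_Fd'_mean_value:
  assumes "0 < a" "a < b" "b \<le> t" "t < 1"
  obtains z where "a < z" "z < b" "rate_Fd' d t b > rate_Fd' d t a \<longleftrightarrow>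
     real d * t / 2 - 1 > (2 - t) * (real d / 2 - 1) * z"
   "rate_Fd' d t b < rate_Fd' d t a \<longleftrightarrow>
     real d * t / 2 - 1 < (2 - t) * (real d / 2 - 1) * z"
proof -
  obtain z where z: "a < z" "z < b" and eq: "rate_Fd' d t b - rate_Fd' d t a = (b - a) *
    (((real d * t / 2 - 1) - (2 - t) * (real d / 2 - 1) * z) / (z * (1 - z) * (1 - (2 - t) * z)))"
  proof (rule MVT_continuous_on[of a b "rate_Fd' d t"])
    show "continuous_on {a..b} (rate_Fd' d t)"
    proof (intro continuous_at_imp_continuous_on ballI)
      fix x assume "x \<in> {a..b}"
      then show "isCont (rate_Fd' d t) x"
        using assms by (intro DERIV_isCont[OF rate_Fd'_has_derivative]) auto
    qed
  next
    fix z assume "a < z" "z < b"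
    then show "(rate_Fd' d t has_real_derivative
      ((real d * t / 2 - 1) - (2 - t) * (real d / 2 - 1) * z) / (z * (1 - z) * (1 - (2 - t) * z))) (at z)"
      using assms by (intro rate_Fd'_has_derivative) auto
  qed (use assms that in auto)
  have pos: "(b - a) / (z * (1 - z) * (1 - (2 - t) * z)) > 0" (is "?c > 0")
    using assms z two_minus_mult_less_one[of z t] by (intro divide_pos_pos mult_pos_pos) auto
  define w where "w = (real d * t / 2 - 1) - (2 - t) * (real d / 2 - 1) * z"
  have eq: "rate_Fd' d t b - rate_Fd' d t a = ?c * w"
    using eq by (simp add: w_def)
  have "?c * w > 0 \<longleftrightarrow> w > 0" "?c * w < 0 \<longleftrightarrow> w < 0"
    using pos by (simp_all only: zero_less_mult_iff mult_less_0_iff) auto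
  then show ?thesis
    using that[OF z] eq unfolding w_def by (smt (verit))
qed

text \<open>
  The mean values below produce a point where the second derivative is positive; a nonnegative
  value before \<open>x0\<close> would also produce a point to its left where it is negative.
\<close>

lemma rate_Fd_neg:
  assumes "d \<ge> 3" "0 < x0" "x0 < t" "t < 1" "rate_Fd d x0 t < 0"
  shows "real d * t > 2" and "\<And>x. 0 < x \<Longrightarrow> x \<le> x0 \<Longrightarrow> rate_Fd d x t < 0"
proof -
  define \<beta> where "\<beta> = (2 - t) * (real d / 2 - 1)"
  have \<beta>: "\<beta> > 0" unfolding \<beta>_def using assms by (intro mult_pos_pos) auto
  have pos: "rate_Fd d t t > 0"
    using assms by (simp add: rate_Fd_diagonal ent2_pos)
  obtain z3 where z3: "x0 < z3" "z3 < t" "rate_Fd d t t - rate_Fd d x0 t = (t - x0) * rate_Fd' d t z3"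
    using rate_Fd_mean_value[of x0 t t] assms by auto
  have z3': "rate_Fd' d t z3 > 0"
    using z3 pos assms by (smt (verit) zero_less_mult_iff)
  {
    fix y assume y: "0 \<le> y" "y < x0" "rate_Fd d y t \<ge> 0"
    obtain z2 where z2: "y < z2" "z2 < x0" "rate_Fd d x0 t - rate_Fd d y t = (x0 - y) * rate_Fd' d t z2"
      using rate_Fd_mean_value[of y x0 t] y assms by auto
    have z2': "rate_Fd' d t z2 < 0"
      using z2 y assms by (smt (verit) mult_nonneg_nonneg)
    obtain w where "z2 < w" "w < z3" "real d * t / 2 - 1 > \<beta> * w"
      using rate_Fd'_mean_value[of z2 z3 t d] z2 z3 z2' z3' y assms unfolding \<beta>_def by auto
    with z2 z2' have "\<exists>z w. y < z \<and> z < x0 \<and> rate_Fd' d t z < 0 \<and> z < w \<and> real d * t / 2 - 1 > \<beta> * w"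
      by blast
  } note right = this
  show "real d * t > 2"
  proof -
    obtain z w where "0 < z" "z < w" "real d * t / 2 - 1 > \<beta> * w"
      using right[of 0] assms by (auto simp: rate_Fd_0)
    then have "w > 0" by simp
    then have "\<beta> * w > 0" using \<beta> by simp
    with \<open>real d * t / 2 - 1 > \<beta> * w\<close> show ?thesis by linarith
  qed
  fix x assume x: "0 < x" "x \<le> x0"
  show "rate_Fd d x t < 0"
  proof (rule ccontr)
    assume "\<not> rate_Fd d x t < 0"
    then have x': "rate_Fd d x t \<ge> 0" "x < x0" using x assms by (auto simp: order_le_less)
    obtain z2 w where z2: "x < z2" "z2 < x0" "rate_Fd' d t z2 < 0" "z2 < w"
      and w: "real d * t / 2 - 1 > \<beta> * w"
      using right[of x] x x' by auto
    obtain z1 where z1: "0 < z1" "z1 < x" "rate_Fd d x t - rate_Fd d 0 t = (x - 0) * rate_Fd' d t z1"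
      using rate_Fd_mean_value[of 0 x t] x x' assms by auto
    have z1': "rate_Fd' d t z1 \<ge> 0"
      using z1 x x' rate_Fd_0 by (simp add: zero_le_mult_iff)
    obtain v where v: "z1 < v" "v < z2" "real d * t / 2 - 1 < \<beta> * v"
      using rate_Fd'_mean_value[of z1 z2 t d] z2 z1 z1' assms unfolding \<beta>_def by auto
    \<comment> \<open>The numerator has slope - \<beta> < 0, so it cannot be negative at v and
      positive at w > v.\<close>
    have "\<beta> * v < \<beta> * w" using v z2 \<beta> by simp
    with v w show False by simp
  qed
qed

section \<open>Upper bounds for the rate function\<close>

lemma rate_Fd_le_near_0:
  assumes "0 < t" "t < 1"
  obtains K where "K > 0" "\<And>x. 0 < x \<Longrightarrow> x \<le> t \<Longrightarrow> rate_Fd d x t \<le> x * ((real d * t / 2 - 1) * ln x + K)"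
proof -
  define K where "K = real d * (ent t / 2 + ent (1 - t) + (2 - t) / 2) + 1"
  have "K > 0" unfolding K_def using assms
    by (intro add_nonneg_pos mult_nonneg_nonneg add_nonneg_nonneg) (auto intro: ent_nonneg)
  moreover have "rate_Fd d x t \<le> x * ((real d * t / 2 - 1) * ln x + K)" if x: "0 < x" "x \<le> t" for x
  proof -
    define u where "u = (2 - t) * x"
    have u: "0 \<le> u" "u \<le> 1"
      using two_minus_mult_less_one[of x t] x assms by (auto simp: u_def)
    have "rate_Fd d x t = real d * (1/2 * ent (t * x) + ent ((1 - t) * x) + 1/2 * ent (1 - u))
     - real d * (ent x + ent (1 - x)) + ent x + ent (1 - x)"
      by (simp add: rate_Fd_eq u_def algebra_simps)
    also have "\<dots> \<le> real d * (1/2 * ent (t * x) + ent ((1 - t) * x) + 1/2 * u)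
      - real d * (ent x + 0) + ent x + x"
      using u x assms by (intro add_mono diff_mono mult_left_mono ent_one_minus_le ent_nonneg) auto
    \<comment> \<open>By \<open>ent_mult\<close>, the coefficients of \<open>ent x\<close> add up to
      d (t/2 + 1 - t) - d + 1 = 1 - d t / 2; all other terms are linear in x.\<close>
    also have "\<dots> = x * ((real d * t / 2 - 1) * ln x + K)"
      using x assms by (simp add: ent_mult u_def K_def) (simp add: ent_eq field_simps)
    finally show ?thesis .
  qed
  ultimately show ?thesis using that by blast
qed

text \<open>In the union bound, \<delta> ln x produces a negative power of N, while - c makes the
  sum over set sizes converge. The two come from a convex combination of the bound near 0 with a
  linear bound, which compactness extends to the rest of the interval.\<close>

lemma rate_Fd_le:
  assumes "d \<ge> 3" "0 < x0" "x0 < t" "t < 1" "rate_Fd d x0 t < 0"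
  obtains c \<delta> where "c > 0" "\<delta> > 0" "\<delta> \<le> 1"
    "\<And>x. 0 < x \<Longrightarrow> x \<le> x0 \<Longrightarrow> rate_Fd d x t \<le> x * (\<delta> * ln x - c)"
proof -
  define \<alpha> where "\<alpha> = real d * t / 2 - 1"
  have \<alpha>: "\<alpha> > 0" using rate_Fd_neg(1)[OF assms] by (simp add: \<alpha>_def)
  obtain K where K: "K > 0" "\<And>x. 0 < x \<Longrightarrow> x \<le> t \<Longrightarrow> rate_Fd d x t \<le> x * (\<alpha> * ln x + K)"
    using rate_Fd_le_near_0[of t d] assms unfolding \<alpha>_def by (metis less_trans)
  \<comment> \<open>Up to this point \<alpha> ln x + K \<le> -1, which matches the cap of c at 1
    below.\<close>
  define x1 where "x1 = min x0 (exp (- (K + 1) / \<alpha>))"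
  have x1: "0 < x1" "x1 \<le> x0" using assms by (auto simp: x1_def)
  obtain b where b: "b \<in> {x1..x0}" "\<And>x. x \<in> {x1..x0} \<Longrightarrow> rate_Fd d x t \<le> rate_Fd d b t"
    using continuous_attains_sup[of "{x1..x0}" "\<lambda>x. rate_Fd d x t"]
      continuous_on_subset[OF continuous_on_rate_Fd[of t d], of "{x1..x0}"] x1 assms
    by fastforce
  have bneg: "rate_Fd d b t < 0"
    using b x1 by (intro rate_Fd_neg(2)[OF assms]) auto
  define c where "c = min 1 (- rate_Fd d b t)"
  have c: "c > 0" using bneg by (simp add: c_def)
  have lin: "rate_Fd d x t \<le> - c * x" if x: "0 < x" "x \<le> x0" for x
  proof (cases "x \<le> x1")
    case True
    then have "ln x \<le> ln (exp (- (K + 1) / \<alpha>))"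
      using x by (subst ln_le_cancel_iff) (auto simp: x1_def)
    then have "\<alpha> * ln x \<le> \<alpha> * (- (K + 1) / \<alpha>)"
      using \<alpha> by (intro mult_left_mono) auto
    then have "\<alpha> * ln x + K \<le> - c" using \<alpha> by (simp add: c_def)
    then have "x * (\<alpha> * ln x + K) \<le> x * (- c)" using x by (intro mult_left_mono) auto
    with K(2)[of x] x assms show ?thesis by (simp add: mult.commute)
  next
    case False
    then have "rate_Fd d x t \<le> rate_Fd d b t" using x by (intro b) auto
    also have "\<dots> \<le> - c * 1" by (simp add: c_def)
    also have "\<dots> \<le> - c * x" using c x assms by simp
    finally show ?thesis .
  qed
  \<comment> \<open>With these bounds, \<theta> K \<le> c/4 and (1 - \<theta>) c \<ge> c/2 leave -
    c/4, and \<theta> \<alpha> \<le> 1 gives \<delta> \<le> 1.\<close>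
  define \<theta> where "\<theta> = min (1/2) (min (1 / \<alpha>) (c / (4 * K)))"
  have \<theta>: "\<theta> > 0" "\<theta> \<le> 1/2" "\<theta> * \<alpha> \<le> 1" "\<theta> * K \<le> c / 4"
  proof -
    show "\<theta> > 0" using \<alpha> c K by (simp add: \<theta>_def)
    have "\<theta> * \<alpha> \<le> 1 / \<alpha> * \<alpha>" using \<alpha> by (intro mult_right_mono) (auto simp: \<theta>_def)
    then show "\<theta> * \<alpha> \<le> 1" using \<alpha> by simp
    have "\<theta> * K \<le> c / (4 * K) * K" using K by (intro mult_right_mono) (auto simp: \<theta>_def)
    then show "\<theta> * K \<le> c / 4" using K by simp
  qed (simp add: \<theta>_def)
  show ?thesis
  proof (rule that[of "c / 4" "\<theta> * \<alpha>"])
    fix x assume x: "0 < x" "x \<le> x0"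
    have "rate_Fd d x t = \<theta> * rate_Fd d x t + (1 - \<theta>) * rate_Fd d x t" by (simp add: algebra_simps)
    also have "\<dots> \<le> \<theta> * (x * (\<alpha> * ln x + K)) + (1 - \<theta>) * (- c * x)"
      using \<theta> x assms by (intro add_mono mult_left_mono K lin) auto
    also have "\<dots> = x * (\<theta> * \<alpha> * ln x + (\<theta> * K - (1 - \<theta>) * c))" by (simp add: algebra_simps)
    also have "\<dots> \<le> x * (\<theta> * \<alpha> * ln x + - (c / 4))"
    proof (intro mult_left_mono add_left_mono)
      have "1/2 * c \<le> (1 - \<theta>) * c" using \<theta> c by (intro mult_right_mono) auto
      then show "\<theta> * K - (1 - \<theta>) * c \<le> - (c / 4)" using \<theta> by linarith
    qed (use x in auto)
    finally show "rate_Fd d x t \<le> x * (\<theta> * \<alpha> * ln x - c / 4)" by simp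
  qed (use \<alpha> \<theta> c in auto)
qed

text \<open>Passing to the complement exchanges the edges with two ends inside and those with none,
  and keeps those with one. The hypothesis makes the first and third entropy arguments trade places,
  and H is symmetric.\<close>

lemma rate_Fd_complement:
  assumes "t' * (1 - x) = 1 - (2 - t) * x"
  shows "rate_Fd d (1 - x) t' = rate_Fd d x t"
proof -
  have "(1 - t') * (1 - x) = (1 - t) * x" "1 - (2 - t') * (1 - x) = t * x"
    using assms by (auto simp: algebra_simps)
  with assms show ?thesis by (simp add: rate_Fd_eq add_ac)
qed

section \<open>Perfect matchings and inner edges\<close>

definition inner_edges :: "'a set set \<Rightarrow> 'a set \<Rightarrow> nat" where
  "inner_edges M X = card {e \<in> M. e \<subseteq> X}"

lemma perfect_matchings_insertE:
  assumes "finite A" "M \<in> perfect_matchings A" "e \<in> M"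
  obtains a b where "e = {a, b}" "a \<noteq> b" "a \<notin> \<Union>(M - {e})" "b \<notin> \<Union>(M - {e})"
    "M - {e} \<in> perfect_matchings (A - e)" "a \<in> A" "b \<in> A"
proof -
  have M: "partition_on A M" "card e = 2" "\<forall>e\<in>M. card e = 2"
    using assms by (auto simp: perfect_matchings_def)
  obtain a b where ab: "e = {a, b}" "a \<noteq> b" using M(2) by (auto simp: card_2_iff)
  have dis: "disjoint M" "A = \<Union>M" using M(1) by (auto simp: partition_on_def)
  have 1: "a \<notin> \<Union>(M - {e})" "b \<notin> \<Union>(M - {e})"
    using disjointD[OF dis(1) _ \<open>e \<in> M\<close>] ab by blast+
  have "partition_on (A - e) (M - {e})"
    using M(1) 1 ab dis assms(3) by (auto simp: partition_on_def disjoint_def)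
  then have "M - {e} \<in> perfect_matchings (A - e)" using M(3) by (auto simp: perfect_matchings_def)
  with ab 1 show ?thesis using that dis assms(3) by blast
qed

lemma perfect_matchings_finite_member: "finite A \<Longrightarrow> M \<in> perfect_matchings A \<Longrightarrow> finite M"
  by (auto simp: perfect_matchings_def intro: finite_elements)

lemma card_perfect_matching:
  assumes "finite A" "M \<in> perfect_matchings A"
  shows "2 * card M = card A"
proof -
  have "card (\<Union>M) = (\<Sum>e\<in>M. card e)"
    using assms by (intro card_Union_disjoint)
      (auto simp: perfect_matchings_def partition_on_def intro: finite_subset)
  also have "\<dots> = 2 * card M"
    using assms by (simp add: perfect_matchings_def)
  finally show ?thesis
    using assms by (simp add: perfect_matchings_def partition_on_def)
qed

lemma sum_Pow_insert:
  assumes "finite A" "a \<notin> A"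
  shows "sum f (Pow (insert a A)) = (\<Sum>X\<in>Pow A. f X + f (insert a X))"
proof -
  have "sum f (Pow (insert a A)) = sum f (Pow A) + sum f (insert a ` Pow A)"
    unfolding Pow_insert using assms by (intro sum.union_disjoint) auto
  also have "sum f (insert a ` Pow A) = (\<Sum>X\<in>Pow A. f (insert a X))"
    using assms by (subst sum.reindex) (auto simp: inj_on_def)
  finally show ?thesis by (simp add: sum.distrib)
qed

text \<open>Each edge contributes \<open>1\<close>, \<open>u\<close> or \<open>u\<^sup>2 v\<close> according to the number of its ends in \<open>X\<close>.\<close>

lemma inner_edges_generating_function:
  fixes u v :: real
  assumes "finite A" "M \<in> perfect_matchings A"
  shows "(\<Sum>X\<in>Pow A. u ^ card X * v ^ inner_edges M X) = (1 + 2 * u + u\<^sup>2 * v) ^ card M"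
  using assms
proof (induction "card M" arbitrary: A M)
  case 0
  then have "M = {}" using perfect_matchings_finite_member by fastforce
  then have "A = {}" using 0 by (auto simp: perfect_matchings_def partition_on_def)
  with \<open>M = {}\<close> show ?case by (simp add: inner_edges_def)
next
  case (Suc n)
  have "finite M" using Suc.prems perfect_matchings_finite_member by blast
  obtain e where e: "e \<in> M" using Suc.hyps(2) by fastforce
  obtain a b where ab: "e = {a, b}" "a \<noteq> b" "a \<notin> \<Union>(M - {e})" "b \<notin> \<Union>(M - {e})"
    and M': "M - {e} \<in> perfect_matchings (A - e)" and abA: "a \<in> A" "b \<in> A"
    using perfect_matchings_insertE[OF Suc.prems e] by metis
  define A' M' where "A' = A - e" and "M' = M - {e}"
  have A: "A = insert a (insert b A')" "a \<notin> insert b A'" "b \<notin> A'" "finite A'"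
    using ab abA Suc.prems by (auto simp: A'_def)
  have M: "M = insert e M'" "e \<notin> M'" "finite M'" "M' \<in> perfect_matchings A'"
    using e M' \<open>finite M\<close> by (auto simp: M'_def A'_def)
  have card: "card M = Suc (card M')" using M by simp
  have UM: "\<Union>M' = A'" using M(4) by (simp add: perfect_matchings_def partition_on_def)
  \<comment> \<open>A subset of A is cut into its part in A' and its trace Z on the removed edge;
    only the full trace adds an inner edge.\<close>
  have filt: "{f \<in> M. f \<subseteq> X \<union> Z} = {f \<in> M'. f \<subseteq> X} \<union> (if Z = {a, b} then {e} else {})"
    if "X \<subseteq> A'" "Z \<subseteq> {a, b}" for X Z
  proof -
    have "f \<subseteq> X \<union> Z \<longleftrightarrow> f \<subseteq> X" if "f \<in> M'" for f
      using that UM A \<open>Z \<subseteq> {a, b}\<close> by blast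
    moreover have "e \<subseteq> X \<union> Z \<longleftrightarrow> Z = {a, b}"
      using that A ab by blast
    ultimately show ?thesis using M by auto
  qed
  have inner: "inner_edges M (X \<union> Z) = inner_edges M' X + (if Z = {a, b} then 1 else 0)"
    if "X \<subseteq> A'" "Z \<subseteq> {a, b}" for X Z
    unfolding inner_edges_def filt[OF that] using M by (subst card_Un_disjoint) auto
  have weight: "u ^ card (X \<union> Z) * v ^ inner_edges M (X \<union> Z)
      = u ^ card X * v ^ inner_edges M' X * (u ^ card Z * (if Z = {a, b} then v else 1))"
    if "X \<subseteq> A'" "Z \<subseteq> {a, b}" for X Z
  proof -
    have "card (X \<union> Z) = card X + card Z"
      using that A by (intro card_Un_disjoint) (auto intro: finite_subset)
    then show ?thesis by (simp add: inner[OF that] power_add)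
  qed
  have "(\<Sum>X\<in>Pow A. u ^ card X * v ^ inner_edges M X)
     = (\<Sum>X\<in>Pow A'. u ^ card X * v ^ inner_edges M' X * (1 + 2 * u + u\<^sup>2 * v))"
    unfolding A(1)
  proof (subst sum_Pow_insert, goal_cases)
    case 3
    show ?case
    proof (subst sum_Pow_insert, goal_cases)
      case 3
      show ?case
      proof (rule sum.cong, goal_cases)
        case (2 X)
        then show ?case
          using weight[of X "{}"] weight[of X "{a}"] weight[of X "{b}"] weight[of X "{a, b}"] ab(2)
          by (simp add: insert_commute algebra_simps power2_eq_square doubleton_eq_iff)
      qed simp
    qed (use A in auto)
  qed (use A in auto)
  also have "\<dots> = (1 + 2 * u + u\<^sup>2 * v) ^ card M' * (1 + 2 * u + u\<^sup>2 * v)"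
    using Suc.hyps(1)[of M' A'] Suc.hyps(2) card M(4) A(4) by (simp add: sum_distrib_right[symmetric])
  finally show ?case by (simp add: card)
qed

text \<open>A permutation of A that carries X to Y acts injectively on perfect matchings and maps
  the inner edges of X onto those of Y.\<close>

lemma card_matchings_inner_edges_le:
  assumes "finite A" "X \<subseteq> A" "Y \<subseteq> A" "card X = card Y"
  shows "card {M \<in> perfect_matchings A. P (inner_edges M X)}
    \<le> card {M \<in> perfect_matchings A. P (inner_edges M Y)}"
proof -
  have fin: "finite X" "finite Y" using assms finite_subset by auto
  have "card (A - X) = card (A - Y)"
    using assms fin by (simp add: card_Diff_subset)
  then obtain f g where f: "bij_betw f X Y" and g: "bij_betw g (A - X) (A - Y)"
    using assms fin by (metis bij_betw_iff_card finite_Diff)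
  define h where "h = (\<lambda>x. if x \<in> X then f x else g x)"
  have hX: "bij_betw h X Y" using f by (subst bij_betw_cong[of _ _ f]) (auto simp: h_def)
  have hX': "bij_betw h (A - X) (A - Y)" using g by (subst bij_betw_cong[of _ _ g]) (auto simp: h_def)
  have h: "bij_betw h A A"
    using bij_betw_combine[OF hX hX'] assms by (simp add: Un_absorb1)
  have inj: "inj_on h A" using h by (rule bij_betw_imp_inj_on)
  have sub: "h ` e \<subseteq> Y \<longleftrightarrow> e \<subseteq> X" if "e \<subseteq> A" for e
  proof -
    have "h ` X = Y" using hX by (simp add: bij_betw_def)
    then show ?thesis using inj that assms by (metis inj_on_image_subset_iff)
  qed
  show ?thesis
  proof (rule card_inj_on_le[where f = "(`) ((`) h)"])
    have "inj_on ((`) h) (Pow A)" using inj by (simp add: inj_on_image_Pow)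
    then have "inj_on ((`) ((`) h)) (Pow (Pow A))" by (rule inj_on_image_Pow)
    then show "inj_on ((`) ((`) h)) {M \<in> perfect_matchings A. P (inner_edges M X)}"
      by (rule inj_on_subset) (auto simp: perfect_matchings_def partition_on_def)
    show "(`) ((`) h) ` {M \<in> perfect_matchings A. P (inner_edges M X)}
      \<subseteq> {M \<in> perfect_matchings A. P (inner_edges M Y)}"
    proof safe
      fix M assume M: "M \<in> perfect_matchings A" and P: "P (inner_edges M X)"
      have MA: "e \<subseteq> A" if "e \<in> M" for e
        using M that by (auto simp: perfect_matchings_def partition_on_def)
      have part: "partition_on A M" using M by (simp add: perfect_matchings_def)
      then have "{} \<notin> (`) h ` M" by (auto simp: partition_on_def)
      with partition_on_inj_image[OF part inj] have "partition_on (h ` A) ((`) h ` M)"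
        by simp
      moreover have "h ` A = A" using h by (simp add: bij_betw_def)
      moreover have "card (h ` e) = 2" if "e \<in> M" for e
        using M that inj_on_subset[OF inj MA[OF that]] by (simp add: card_image perfect_matchings_def)
      ultimately show "(`) h ` M \<in> perfect_matchings A" by (auto simp: perfect_matchings_def)
      have "{e \<in> (`) h ` M. e \<subseteq> Y} = (`) h ` {e \<in> M. e \<subseteq> X}"
        using sub MA by auto
      moreover have "inj_on ((`) h) {e \<in> M. e \<subseteq> X}"
        using \<open>inj_on ((`) h) (Pow A)\<close> by (rule inj_on_subset) (use MA in auto)
      ultimately have "inner_edges ((`) h ` M) Y = inner_edges M X"
        by (simp add: inner_edges_def card_image)
      with P show "P (inner_edges ((`) h ` M) Y)" by simp
    qed
    show "finite {M \<in> perfect_matchings A. P (inner_edges M Y)}"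
      using finite_perfect_matchings[OF assms(1)] by simp
  qed
qed

lemma card_matchings_inner_edges_eq:
  assumes "finite A" "X \<subseteq> A" "Y \<subseteq> A" "card X = card Y"
  shows "card {M \<in> perfect_matchings A. P (inner_edges M X)}
    = card {M \<in> perfect_matchings A. P (inner_edges M Y)}"
  using card_matchings_inner_edges_le[of A X Y P] card_matchings_inner_edges_le[of A Y X P] assms
  by simp

text \<open>
  By symmetry, the probability of the event for a fixed \<open>X0\<close> is the average over all \<open>l\<close>-sets, which
  can be estimated for each matching separately. This avoids counting perfect matchings.
\<close>

lemma double_count_inner_edges:
  assumes "finite A" "X0 \<subseteq> A" "card X0 = l"
    and "\<And>M. M \<in> perfect_matchings A \<Longrightarrow> real (card {X. X \<subseteq> A \<and> card X = l \<and> P (inner_edges M X)}) \<le> B"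
  shows "real (card A choose l) * card {M \<in> perfect_matchings A. P (inner_edges M X0)}
     \<le> B * card (perfect_matchings A)"
proof -
  let ?PM = "perfect_matchings A" and ?S = "{X. X \<subseteq> A \<and> card X = l}"
  have fin: "finite ?PM" "finite ?S" using assms finite_perfect_matchings by auto
  have "(card A choose l) * card {M \<in> ?PM. P (inner_edges M X0)} = (\<Sum>X\<in>?S. card {M \<in> ?PM. P (inner_edges M X)})"
  proof -
    have "card {M \<in> ?PM. P (inner_edges M X)} = card {M \<in> ?PM. P (inner_edges M X0)}" if "X \<in> ?S" for X
      using that assms by (intro card_matchings_inner_edges_eq) auto
    then show ?thesis using n_subsets[OF assms(1), of l] by simp
  qed
  also have "\<dots> = (\<Sum>M\<in>?PM. card {X \<in> ?S. P (inner_edges M X)})"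
    using sum.swap_restrict[OF fin(2,1), of "\<lambda>_ _. 1::nat" "\<lambda>X M. P (inner_edges M X)"] by simp
  finally have "real (card A choose l) * card {M \<in> ?PM. P (inner_edges M X0)}
     = (\<Sum>M\<in>?PM. real (card {X \<in> ?S. P (inner_edges M X)}))"
    unfolding of_nat_mult[symmetric] by simp
  also have "\<dots> \<le> (\<Sum>M\<in>?PM. B)"
    by (intro sum_mono) (use assms(4) in auto)
  finally show ?thesis by (simp add: mult.commute)
qed

section \<open>Entropy bounds\<close>

text \<open>Logarithm of \<open>n! e\<^sup>n / n\<^sup>n\<close>, which grows with \<open>n\<close>, but at most linearly.\<close>

definition ln_stirling :: "nat \<Rightarrow> real" where
  "ln_stirling n = ln (fact n) + n - n * ln n"

text \<open>Both parts reduce to ln (1 + y) \<le> y, at y = 1/n and at y = - 1/(n + 1).\<close>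

lemma ln_stirling_Suc:
  assumes "n > 0"
  shows "ln_stirling n \<le> ln_stirling (Suc n)"
    and "ln_stirling (Suc n) - ln (Suc n) \<le> ln_stirling n - ln n"
proof -
  have fact: "ln (fact (Suc n) :: real) = ln (Suc n) + ln (fact n)"
    by (simp add: ln_mult add_pos_nonneg del: of_nat_Suc)
  have eq: "ln (real (Suc n)) - ln n = ln (1 + 1 / n)" "ln (real n) - ln (Suc n) = ln (1 - 1 / Suc n)"
  proof -
    have "1 + 1 / real n = Suc n / n" "1 - 1 / real (Suc n) = n / Suc n"
      using assms by (simp_all add: field_simps)
    then show "ln (real (Suc n)) - ln n = ln (1 + 1 / n)" "ln (real n) - ln (Suc n) = ln (1 - 1 / Suc n)"
      using assms by (simp_all add: ln_div del: of_nat_Suc)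
  qed
  have "ln (1 + 1 / real n) \<le> 1 / n" by (intro ln_add_one_self_le_self) simp
  then have "n * (ln (real (Suc n)) - ln n) \<le> n * (1 / n)"
    unfolding eq by (intro mult_left_mono) auto
  then show "ln_stirling n \<le> ln_stirling (Suc n)"
    using assms fact unfolding ln_stirling_def by (simp add: algebra_simps)
  have "ln (1 - 1 / real (Suc n)) \<le> - 1 / Suc n"
    using ln_add_one_self_le_self2[of "- 1 / real (Suc n)"] assms by simp
  then have "Suc n * (ln (real n) - ln (Suc n)) \<le> Suc n * (- 1 / Suc n)"
    unfolding eq by (intro mult_left_mono) auto
  then show "ln_stirling (Suc n) - ln (Suc n) \<le> ln_stirling n - ln n"
    using fact unfolding ln_stirling_def by (simp add: algebra_simps)
qed

lemma ln_stirling_mono: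
  assumes "0 < m" "m \<le> n"
  shows "ln_stirling m \<le> ln_stirling n"
  using assms(2)
proof (induction n rule: dec_induct)
  case (step n)
  then show ?case using ln_stirling_Suc(1)[of n] assms(1) by linarith
qed simp

lemma ln_stirling_le: "0 < n \<Longrightarrow> ln_stirling n \<le> 1 + ln n"
proof (induction n rule: nat_induct_non_zero)
  case 1
  then show ?case by (simp add: ln_stirling_def)
next
  case (Suc n)
  then show ?case using ln_stirling_Suc(2)[of n] by linarith
qed

section \<open>Binomial coefficients and the entropy H\<close>

lemma ent2_quotient:
  assumes "0 < l" "l < n"
  shows "n * ent2 (l / n) = n * ln n - l * ln l - (n - l) * ln (n - l :: nat)"
proof -
  have "1 - l / n = (n - l :: nat) / n" using assms by (simp add: field_simps of_nat_diff)
  then show ?thesis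
    using assms by (simp add: ent2_def ent_eq ln_div field_simps of_nat_diff)
qed

text \<open>Monotonicity of \<open>ln_stirling\<close> absorbs the n - l term into the n term, so
  the loss depends on l alone. A factor growing with n would ruin the union bound for sets of
  bounded size, where only a small power of N is gained.\<close>

lemma exp_ent2_le_binomial:
  assumes "0 < l" "l < n"
  shows "exp (n * ent2 (l / n)) \<le> exp 1 * l * (n choose l)"
proof -
  have "ln (real (n choose l)) = ln (fact n) - ln (fact l) - ln (fact (n - l))"
    using assms by (simp add: binomial_fact ln_div ln_mult)
  also have "\<dots> = ln_stirling n - ln_stirling l - ln_stirling (n - l) + n * ent2 (l / n)"
    using assms by (simp add: ln_stirling_def ent2_quotient of_nat_diff algebra_simps)
  also have "\<dots> \<ge> n * ent2 (l / n) - (1 + ln l)"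
    using ln_stirling_mono[of "n - l" n] ln_stirling_le[of l] assms by simp
  finally have "exp (n * ent2 (l / n)) \<le> exp (ln (real (n choose l)) + 1 + ln l)" by simp
  also have "\<dots> = exp 1 * l * (n choose l)"
    using assms by (simp add: exp_add)
  finally show ?thesis .
qed

text \<open>At p = l/n, one term of the expansion of (p + (1 - p))^n = 1 is the binomial coefficient
  times exp (- n H(p)).\<close>

lemma binomial_le_exp_ent2:
  assumes "0 < l" "l < n"
  shows "real (n choose l) \<le> exp (n * ent2 (l / n))"
proof -
  define p where "p = l / n"
  have p: "0 < p" "p < 1" using assms by (auto simp: p_def)
  have "(n choose l) * p ^ l * (1 - p) ^ (n - l) \<le> (\<Sum>k\<le>n. (n choose k) * p ^ k * (1 - p) ^ (n - k))"
    using p assms by (intro member_le_sum) auto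
  also have "\<dots> = 1" using binomial_ring[of p "1 - p" n] by simp
  finally have *: "(n choose l) * p ^ l * (1 - p) ^ (n - l) \<le> 1" .
  have "p ^ l * (1 - p) ^ (n - l) = exp (l * ln p + (n - l :: nat) * ln (1 - p))"
    using p by (simp add: exp_add exp_of_nat_mult)
  also have "l * ln p + (n - l :: nat) * ln (1 - p) = - (n * ent2 p)"
    using assms by (simp add: ent2_def ent_eq p_def of_nat_diff field_simps)
  finally have E: "p ^ l * (1 - p) ^ (n - l) * exp (n * ent2 p) = 1" by (simp flip: exp_add)
  have "real (n choose l) = (n choose l) * (p ^ l * (1 - p) ^ (n - l) * exp (n * ent2 p))"
    by (subst E) simp
  also have "\<dots> = (n choose l) * p ^ l * (1 - p) ^ (n - l) * exp (n * ent2 p)"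
    by (simp only: mult.assoc)
  also have "\<dots> \<le> 1 * exp (n * ent2 p)"
    using * by (rule mult_right_mono) simp
  finally show ?thesis by (simp add: p_def)
qed

text \<open>
  The weights \<open>p\<close>, \<open>2 q\<close>, \<open>w\<close> are the fractions of edges with two, one and no ends in a set with
  exactly the fraction \<open>t\<close> of internal half-edges, normalised below by \<open>w\<close> to \<open>u\<^sup>2 v\<close>, \<open>2 u\<close>, \<open>1\<close>.
  The condition \<open>x \<le> t\<close> gives \<open>v \<ge> 1\<close>, so that sets with more internal edges weigh at least as much.
\<close>

lemma card_inner_edges_le:
  fixes t x :: real
  assumes "finite A" "M \<in> perfect_matchings A" "card A = 2 * n" "n > 0"
    and "x = l / (2 * n)" "0 < x" "x \<le> t" "t < 1"
  shows "real (card {X. X \<subseteq> A \<and> card X = l \<and> t * l \<le> 2 * real (inner_edges M X)})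
    \<le> exp (2 * n * (1/2 * ent (t * x) + ent ((1 - t) * x) + 1/2 * ent (1 - (2 - t) * x)))"
proof -
  define p q w where "p = t * x" and "q = (1 - t) * x" and "w = 1 - (2 - t) * x"
  have pos: "p > 0" "q > 0" "w > 0"
    using assms(6-8) two_minus_mult_less_one[of x t] by (auto simp: p_def q_def w_def)
  define u v where "u = q / w" and "v = p * w / q\<^sup>2"
  have uv: "u > 0" "v > 0" using pos by (auto simp: u_def v_def)
  have "p * w - q\<^sup>2 = x * (t - x)"
    by (simp add: p_def q_def w_def power2_eq_square algebra_simps)
  also have "\<dots> \<ge> 0" using assms by simp
  finally have v: "v \<ge> 1" using pos by (simp add: v_def)
  define S where "S = {X. X \<subseteq> A \<and> card X = l \<and> t * l \<le> 2 * real (inner_edges M X)}"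
  have finS: "finite S" using assms by (simp add: S_def)
  have n: "card M = n" using card_perfect_matching[OF assms(1,2)] assms(3) by simp
  \<comment> \<open>Chernoff bound: every set in S contributes at least this weight to the
    generating function. The exponent of v is real because t l / 2 need not be an integer.\<close>
  have "card S * (u ^ l * v powr (t * l / 2)) = (\<Sum>X\<in>S. u ^ l * v powr (t * l / 2))" by simp
  also have "\<dots> \<le> (\<Sum>X\<in>S. u ^ card X * v ^ inner_edges M X)"
  proof (rule sum_mono)
    fix X assume X: "X \<in> S"
    then have "v powr (t * l / 2) \<le> v powr inner_edges M X"
      using v by (intro powr_mono) (auto simp: S_def)
    with X uv show "u ^ l * v powr (t * l / 2) \<le> u ^ card X * v ^ inner_edges M X"
      by (auto simp: S_def powr_realpow)
  qed
  also have "\<dots> \<le> (\<Sum>X\<in>Pow A. u ^ card X * v ^ inner_edges M X)"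
    using uv assms by (intro sum_mono2) (auto simp: S_def)
  also have "\<dots> = (1 + 2 * u + u\<^sup>2 * v) ^ n"
    using inner_edges_generating_function[OF assms(1,2)] n by simp
  also have "1 + 2 * u + u\<^sup>2 * v = (w + 2 * q + p) / w"
    using pos by (simp add: u_def v_def field_simps power2_eq_square)
  also have "w + 2 * q + p = 1" by (simp add: p_def q_def w_def algebra_simps)
  finally have "real (card S) * (u ^ l * v powr (t * l / 2)) \<le> (1 / w) ^ n" .
  then have "real (card S) \<le> (1 / w) ^ n / (u ^ l * v powr (t * l / 2))"
    using uv by (subst pos_le_divide_eq) auto
  also have "\<dots> = exp (- n * ln w - l * ln u - t * l / 2 * ln v)"
  proof -
    have "u ^ l = exp (l * ln u)" "(1 / w) ^ n = exp (- n * ln w)" "v powr (t * l / 2) = exp (t * l / 2 * ln v)"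
      using uv pos by (simp_all add: exp_of_nat_mult exp_minus powr_def power_one_over divide_simps)
    then show ?thesis by (simp only: exp_diff divide_divide_eq_left)
  qed
  \<comment> \<open>With l = 2 n x, the coefficients of ln p, ln q and ln w become - n p, - 2 n q
    and - n w.\<close>
  also have "- n * ln w - l * ln u - t * l / 2 * ln v = 2 * n * (1/2 * ent p + ent q + 1/2 * ent w)"
  proof -
    have l: "real l = 2 * n * x" using assms by simp
    have L: "ln u = ln q - ln w" "ln v = ln p + ln w - 2 * ln q"
      using pos by (simp_all add: u_def v_def ln_div ln_mult ln_realpow)
    have E: "ent p = - (t * x) * ln p" "ent q = - ((1 - t) * x) * ln q"
      "ent w = - (1 - (2 - t) * x) * ln w"
      by (simp_all add: ent_eq p_def q_def w_def)
    show ?thesis unfolding l L E by (simp add: algebra_simps)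
  qed
  finally show ?thesis by (simp add: S_def p_def q_def w_def)
qed

text \<open>Averaging over l-sets turns the count for each matching into a probability. Dividing by
  the binomial coefficient subtracts H(x) in the exponent, at the cost of the factor e l.\<close>

lemma card_matchings_many_inner_edges:
  fixes t x :: real
  assumes "finite A" "card A = 2 * n" "n > 0" "X \<subseteq> A" "card X = l" "0 < l"
    and "x = l / (2 * n)" "x \<le> t" "t < 1"
  shows "real (card {M \<in> perfect_matchings A. t * l \<le> 2 * real (inner_edges M X)})
    \<le> exp 1 * l * exp (2 * n * rate_F x t) * card (perfect_matchings A)"
proof -
  have x: "0 < x" "x < 1" using assms(3,6,7) assms(8,9) by (simp, linarith)
  then have "real l < real (2 * n)" using assms(3,7) by (simp add: field_simps)
  then have l: "l < 2 * n" by (simp only: of_nat_less_iff)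
  define G where "G = 1/2 * ent (t * x) + ent ((1 - t) * x) + 1/2 * ent (1 - (2 - t) * x)"
  define m where "m = card {M \<in> perfect_matchings A. t * l \<le> 2 * real (inner_edges M X)}"
  have "real (card A choose l) * m \<le> exp (2 * n * G) * card (perfect_matchings A)"
    unfolding m_def G_def
    by (rule double_count_inner_edges[where P = "\<lambda>i. t * l \<le> 2 * real i"])
      (use assms x card_inner_edges_le[of A _ n x l t] in auto)
  moreover have "exp (2 * n * ent2 x) \<le> exp 1 * l * (2 * n choose l)"
    using exp_ent2_le_binomial[of l "2 * n"] assms l by simp
  ultimately have "exp (2 * n * ent2 x) * m \<le> exp 1 * l * (exp (2 * n * G) * card (perfect_matchings A))"
  proof -
    assume 1: "real (card A choose l) * m \<le> exp (2 * n * G) * card (perfect_matchings A)"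
      and 2: "exp (2 * n * ent2 x) \<le> exp 1 * l * (2 * n choose l)"
    have "exp (2 * n * ent2 x) * m \<le> exp 1 * l * (2 * n choose l) * m"
      using 2 by (rule mult_right_mono) simp
    also have "\<dots> = exp 1 * l * ((card A choose l) * m)" using assms by simp
    also have "\<dots> \<le> exp 1 * l * (exp (2 * n * G) * card (perfect_matchings A))"
      using 1 by (intro mult_left_mono) auto
    finally show ?thesis .
  qed
  moreover have "exp (2 * n * rate_F x t) = exp (2 * n * G) / exp (2 * n * ent2 x)"
    unfolding rate_F_def G_def by (simp add: exp_diff[symmetric] algebra_simps)
  ultimately have "real m \<le> exp 1 * l * (exp (2 * n * rate_F x t) * card (perfect_matchings A))"
    by (simp add: pos_le_divide_eq mult_ac)
  then show ?thesis by (simp add: m_def mult_ac)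
qed

section \<open>Star decompositions from Hall's condition\<close>

text \<open>If some nonempty proper subset J is tight, it is matched first; the condition for the
  rest, with the images of J removed, follows from that for K \<union> J. Otherwise every nonempty
  proper subset has an image to spare, so one element can be matched arbitrarily.\<close>

lemma hall_marriage:
  fixes S :: "'a \<Rightarrow> 'b set"
  assumes "finite E" "\<And>e. e \<in> E \<Longrightarrow> finite (S e)"
    and "\<And>J. J \<subseteq> E \<Longrightarrow> card J \<le> card (\<Union>(S ` J))"
  shows "\<exists>f. inj_on f E \<and> (\<forall>e\<in>E. f e \<in> S e)"
  using assms
proof (induction E arbitrary: S rule: finite_psubset_induct)
  case (psubset E)
  have fin: "finite J" "finite (\<Union>(S ` J))" if "J \<subseteq> E" for J
  proof -
    show "finite J" using that psubset.hyps by (rule finite_subset)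
    then show "finite (\<Union>(S ` J))" using that psubset.prems(1) by blast
  qed
  show ?case
  proof (cases "\<exists>J. J \<noteq> {} \<and> J \<subset> E \<and> card (\<Union>(S ` J)) = card J")
    case True
    then obtain J where J: "J \<noteq> {}" "J \<subset> E" "card (\<Union>(S ` J)) = card J" by blast
    define T where "T = \<Union>(S ` J)"
    have finT: "finite T" using fin[of J] J by (auto simp: T_def)
    have "\<exists>f. inj_on f J \<and> (\<forall>e\<in>J. f e \<in> S e)"
      using J psubset.prems by (intro psubset.IH) auto
    then obtain f where f: "inj_on f J" "\<And>e. e \<in> J \<Longrightarrow> f e \<in> S e" by blast
    have "\<exists>g. inj_on g (E - J) \<and> (\<forall>e\<in>E - J. g e \<in> S e - T)"
    proof (rule psubset.IH)
      show "E - J \<subset> E" using J by blast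
      show "finite (S e - T)" if "e \<in> E - J" for e using that psubset.prems(1) by simp
      fix K assume K: "K \<subseteq> E - J"
      have "card K + card J = card (K \<union> J)"
        using K J fin(1)[of K] fin(1)[of J] by (intro card_Un_disjoint[symmetric]) auto
      also have "\<dots> \<le> card (\<Union>(S ` (K \<union> J)))" using K J by (intro psubset.prems(2)) auto
      also have "\<Union>(S ` (K \<union> J)) = (\<Union>e\<in>K. S e - T) \<union> T" by (auto simp: T_def)
      also have "card \<dots> \<le> card (\<Union>e\<in>K. S e - T) + card T" by (rule card_Un_le)
      finally show "card K \<le> card (\<Union>e\<in>K. S e - T)" using J by (simp add: T_def)
    qed
    then obtain g where g: "inj_on g (E - J)" "\<And>e. e \<in> E - J \<Longrightarrow> g e \<in> S e - T" by blast
    define h where "h = (\<lambda>e. if e \<in> J then f e else g e)"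
    have "inj_on h (J \<union> (E - J))"
    proof (subst inj_on_Un, intro conjI)
      show "inj_on h J" "inj_on h (E - J)"
        using f g by (auto simp: h_def inj_on_def)
      show "h ` (J - (E - J)) \<inter> h ` (E - J - J) = {}"
      proof -
        have "h ` J \<subseteq> T" using f(2) by (auto simp: h_def T_def)
        moreover have "h ` (E - J) \<inter> T = {}" using g(2) by (auto simp: h_def)
        ultimately show ?thesis by blast
      qed
    qed
    moreover have "J \<union> (E - J) = E" using J by blast
    moreover have "h e \<in> S e" if "e \<in> E" for e using that f g by (auto simp: h_def)
    ultimately show ?thesis by auto
  next
    case noncritical: False
    show ?thesis
    proof (cases "E = {}")
      case False
      then obtain e where e: "e \<in> E" by blast
      have "card {e} \<le> card (\<Union>(S ` {e}))" using e by (intro psubset.prems(2)) auto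
      then obtain y where y: "y \<in> S e" by fastforce
      have "\<exists>f. inj_on f (E - {e}) \<and> (\<forall>x\<in>E - {e}. f x \<in> S x - {y})"
      proof (rule psubset.IH)
        show "E - {e} \<subset> E" using e by blast
        show "finite (S x - {y})" if "x \<in> E - {e}" for x using that psubset.prems(1) by simp
        fix K assume K: "K \<subseteq> E - {e}"
        show "card K \<le> card (\<Union>x\<in>K. S x - {y})"
        proof (cases "K = {}")
          case False
          have "K \<subset> E" using K e by blast
          then have "card K < card (\<Union>(S ` K))"
            using noncritical \<open>K \<noteq> {}\<close> psubset.prems(2)[of K]
            by (metis nat_less_le psubset_imp_subset)
          moreover have sub_ins: "\<Union>(S ` K) \<subseteq> insert y (\<Union>x\<in>K. S x - {y})" by auto
          moreover have fin_ins: "finite (insert y (\<Union>x\<in>K. S x - {y}))"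
            by (rule finite_subset[of _ "insert y (\<Union>(S ` K))"]) (use fin(2)[of K] K in auto)
          moreover have "card (\<Union>(S ` K)) \<le> card (insert y (\<Union>x\<in>K. S x - {y}))"
            using fin_ins sub_ins by (rule card_mono)
          moreover have "card (insert y (\<Union>x\<in>K. S x - {y})) \<le> Suc (card (\<Union>x\<in>K. S x - {y}))"
            by (rule card_insert_le_m1) auto
          ultimately show ?thesis by linarith
        qed simp
      qed
      then obtain f where "inj_on f (E - {e})" "\<forall>x\<in>E - {e}. f x \<in> S x - {y}" by blast
      then show ?thesis using e y by (intro exI[of _ "f(e := y)"]) (auto simp: inj_on_def)
    qed simp
  qed
qed

text \<open>Each vertex v offers k j(v) slots, and Hall's theorem assigns to every edge its own slot
  at one of its ends. The total count makes all slots used, and blocks of k slots become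
  stars.\<close>

lemma ex_star_decomposition:
  fixes ends :: "'e \<Rightarrow> 'v set"
  assumes "finite M" "finite V" "k > 0" "\<And>e. e \<in> M \<Longrightarrow> ends e \<subseteq> V"
    and total: "k * (\<Sum>v\<in>V. j v) = card M"
    and hall: "\<And>U. U \<subseteq> V \<Longrightarrow> card {e \<in> M. ends e \<subseteq> U} \<le> k * (\<Sum>v\<in>U. j v)"
  shows "\<exists>P c. k_star_decomposition M ends k P c \<and> (\<forall>v\<in>V. card {S \<in> P. c S = v} = j v)"
proof -
  define slots where "slots = (\<lambda>U. SIGMA v:U. {..<k * j v})"
  have card_slots: "card (slots U) = k * (\<Sum>v\<in>U. j v)" "finite (slots U)" if "U \<subseteq> V" for U
    using finite_subset[OF that assms(2)] by (auto simp: slots_def card_SigmaI sum_distrib_left)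
  have "\<exists>f. inj_on f M \<and> (\<forall>e\<in>M. f e \<in> slots (ends e))"
  proof (rule hall_marriage)
    show "finite (slots (ends e))" if "e \<in> M" for e using that assms card_slots by blast
    fix J assume J: "J \<subseteq> M"
    define U where "U = \<Union>(ends ` J)"
    have U: "U \<subseteq> V" using J assms by (auto simp: U_def)
    \<comment> \<open>J lies among all edges spanned by U and has the same slots available, so the
      condition on vertex sets suffices.\<close>
    have "card J \<le> card {e \<in> M. ends e \<subseteq> U}"
      using J assms by (intro card_mono) (auto simp: U_def)
    also have "\<dots> \<le> card (slots U)" using hall[OF U] card_slots[OF U] by simp
    also have "slots U = (\<Union>e\<in>J. slots (ends e))" by (auto simp: slots_def U_def)
    finally show "card J \<le> card (\<Union>e\<in>J. slots (ends e))" .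
  qed fact
  then obtain f where f: "inj_on f M" "\<And>e. e \<in> M \<Longrightarrow> f e \<in> slots (ends e)" by blast
  have "f ` M \<subseteq> slots V" using f(2) assms(4) by (fastforce simp: slots_def)
  moreover have "card (f ` M) = card (slots V)" using f(1) card_slots total by (simp add: card_image)
  ultimately have im: "f ` M = slots V" using card_slots by (intro card_subset_eq) auto
  have div_mod_bounds: "m div k = q \<longleftrightarrow> q * k \<le> m \<and> m < q * k + k" for m q :: nat
    using div_nat_eqI[of k q m] dividend_less_times_div[OF \<open>k > 0\<close>, of m] times_div_less_eq_dividend[of k m]
    by (auto simp: mult.commute add.commute)
  define I where "I = (SIGMA v:V. {..<j v})"
  \<comment> \<open>The slots at v are cut into consecutive blocks of length k; the star (v, q)
    consists of the edges in block q.\<close>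
  define star where "star = (\<lambda>(v, q). {e \<in> M. fst (f e) = v \<and> snd (f e) div k = q})"
  have idx: "(fst (f e), snd (f e) div k) \<in> I" if "e \<in> M" for e
  proof -
    have "f e \<in> slots V" using im that by blast
    then show ?thesis using \<open>k > 0\<close>
      by (auto simp: slots_def I_def less_mult_imp_div_less mult.commute)
  qed
  have card_star: "card (star p) = k" if "p \<in> I" for p
  proof -
    obtain v q where p: "p = (v, q)" "v \<in> V" "q < j v" using \<open>p \<in> I\<close> by (auto simp: I_def)
    have "f ` star p = {v} \<times> {q * k..<q * k + k}"
    proof (rule set_eqI)
      fix z
      have "z \<in> f ` star p \<longleftrightarrow> z \<in> f ` M \<and> fst z = v \<and> snd z div k = q"
        by (auto simp: star_def p)
      also have "\<dots> \<longleftrightarrow> fst z = v \<and> snd z < k * j v \<and> snd z div k = q"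
        unfolding im using p by (cases z) (auto simp: slots_def)
      also have "\<dots> \<longleftrightarrow> fst z = v \<and> snd z div k = q"
        using p div_less_iff_less_mult[OF \<open>k > 0\<close>, of "snd z" "j v"] by (auto simp: mult.commute)
      also have "\<dots> \<longleftrightarrow> z \<in> {v} \<times> {q * k..<q * k + k}"
        using div_mod_bounds[of "snd z"] by (cases z) auto
      finally show "z \<in> f ` star p \<longleftrightarrow> z \<in> {v} \<times> {q * k..<q * k + k}" .
    qed
    moreover have "inj_on f (star p)" using f(1) by (rule inj_on_subset) (auto simp: star_def p)
    ultimately show ?thesis using card_image[of f "star p"] by simp
  qed
  \<comment> \<open>All edges of a star have their slots at the same vertex, so any choice of edge
    returns the center.\<close>
  define c where "c = (\<lambda>S. fst (f (SOME e. e \<in> S)))"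
  have ne: "star p \<noteq> {}" if "p \<in> I" for p using card_star[OF that] \<open>k > 0\<close> by auto
  have c_star: "c (star p) = fst p" if "p \<in> I" for p
  proof -
    have "(SOME e. e \<in> star p) \<in> star p" using ne[OF that] by (simp add: some_in_eq)
    then show ?thesis by (auto simp: c_def star_def split: prod.splits)
  qed
  have star_disj: "p = q" if "star p \<inter> star q \<noteq> {}" for p q
    using that by (auto simp: star_def split: prod.splits)
  have part: "partition_on M (star ` I)"
  proof (rule partition_onI)
    show "\<Union>(star ` I) = M"
    proof
      show "M \<subseteq> \<Union>(star ` I)"
      proof
        fix e assume "e \<in> M"
        then show "e \<in> \<Union>(star ` I)"
          by (intro UnionI[OF imageI[OF idx]]) (auto simp: star_def)
      qed
    qed (auto simp: star_def)
    show "disjnt S T" if "S \<in> star ` I" "T \<in> star ` I" "S \<noteq> T" for S T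
      using that star_disj by (fastforce simp: disjnt_def)
    show "{} \<notin> star ` I" using ne by force
  qed
  moreover have "k_star ends k (c S) S" if "S \<in> star ` I" for S
  proof -
    obtain p where p: "p \<in> I" "S = star p" using \<open>S \<in> star ` I\<close> by blast
    have "fst p \<in> ends e" if "e \<in> S" for e
      using that f(2)[of e] by (auto simp: p star_def slots_def split: prod.splits)
    moreover have "finite S" using assms(1) by (auto simp: p star_def split: prod.splits)
    ultimately show ?thesis using card_star[OF p(1)] c_star[OF p(1)] by (simp add: k_star_def p)
  qed
  moreover have "card {S \<in> star ` I. c S = v} = j v" if "v \<in> V" for v
  proof -
    have "{S \<in> star ` I. c S = v} = star ` ({v} \<times> {..<j v})"
      using that c_star by (fastforce simp: I_def)
    moreover have "inj_on star ({v} \<times> {..<j v})"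
    proof (rule inj_onI)
      fix p q assume "p \<in> {v} \<times> {..<j v}" "star p = star q"
      then have "star p \<inter> star q \<noteq> {}" using ne[of p] that by (auto simp: I_def)
      then show "p = q" by (rule star_disj)
    qed
    ultimately show ?thesis by (simp add: card_image)
  qed
  ultimately show ?thesis unfolding k_star_decomposition_def by blast
qed

text \<open>An edge with i ends in X satisfies [i = 0] + i = 1 + [i = 2]; summing over the matching
  gives the identity.\<close>

lemma inner_edges_complement:
  assumes "finite A" "M \<in> perfect_matchings A" "X \<subseteq> A"
  shows "inner_edges M (A - X) + card X = card M + inner_edges M X"
proof -
  have M: "partition_on A M" "\<And>e. e \<in> M \<Longrightarrow> card e = 2"
    using assms by (auto simp: perfect_matchings_def)
  have fin: "finite M" using assms perfect_matchings_finite_member by blast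
  have count: "inner_edges M Y = (\<Sum>e\<in>M. if e \<subseteq> Y then 1 else 0)" for Y
    using fin by (simp add: inner_edges_def sum.If_cases Int_def)
  have "X = (\<Union>e\<in>M. e \<inter> X)" using M(1) assms(3) by (auto simp: partition_on_def)
  also have "card \<dots> = (\<Sum>e\<in>M. card (e \<inter> X))"
  proof (rule card_UN_disjoint)
    show "\<forall>e\<in>M. finite (e \<inter> X)" using assms finite_subset by blast
    show "\<forall>e\<in>M. \<forall>e'\<in>M. e \<noteq> e' \<longrightarrow> (e \<inter> X) \<inter> (e' \<inter> X) = {}"
      using M(1) by (auto simp: partition_on_def disjoint_def)
  qed (rule fin)
  finally have "inner_edges M (A - X) + card X
      = (\<Sum>e\<in>M. (if e \<subseteq> A - X then 1 else 0) + card (e \<inter> X))"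
    by (simp add: count sum.distrib)
  also have "\<dots> = (\<Sum>e\<in>M. 1 + (if e \<subseteq> X then 1 else 0))"
  proof (rule sum.cong)
    fix e assume e: "e \<in> M"
    obtain a b where ab: "e = {a, b}" "a \<noteq> b" using M(2)[OF e] by (auto simp: card_2_iff)
    moreover have "e \<subseteq> A" using M(1) e by (auto simp: partition_on_def)
    ultimately show "(if e \<subseteq> A - X then 1 else 0) + card (e \<inter> X) = 1 + (if e \<subseteq> X then 1 else 0)"
      by (cases "a \<in> X"; cases "b \<in> X") (auto simp: Int_insert_left)
  qed simp
  also have "\<dots> = card M + inner_edges M X" by (simp only: sum.distrib count) simp
  finally show ?thesis .
qed

text \<open>The equation for \<open>card B\<close> makes the total number of stars correct. The
  bound \<open>large\<close> encodes the density (d - 2 k + r) / d, with the term in 2 k moved to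
  the left to avoid subtraction of natural numbers.\<close>

lemma ex_star_decomposition_config:
  assumes M: "M \<in> perfect_matchings (half_edges N d)"
    and AB: "A \<union> B = {1..N}" "A \<inter> B = {}"
    and k: "k > 0" "d = 2 * s * k + r" "2 * k * card B = r * N"
    and small: "\<And>U. U \<subseteq> {1..N} \<Longrightarrow> card U \<le> card A \<Longrightarrow> inner_edges M (U \<times> {1..d}) \<le> k * s * card U"
    and large: "\<And>W. W \<subseteq> {1..N} \<Longrightarrow> card W \<le> card B \<Longrightarrow>
      2 * inner_edges M (W \<times> {1..d}) + 2 * k * card W \<le> (d + r) * card W"
  shows "\<exists>P c. k_star_decomposition M config_ends k P c \<and>
    (\<forall>v\<in>A. card {S \<in> P. c S = v} = s) \<and> (\<forall>v\<in>B. card {S \<in> P. c S = v} = s + 1)"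
proof -
  have fin: "finite (half_edges N d)" by (simp add: half_edges_def)
  have MH: "e \<subseteq> half_edges N d" if "e \<in> M" for e
    using M that by (auto simp: perfect_matchings_def partition_on_def)
  have finAB: "finite A" "finite B" using AB by (metis finite_Un finite_atLeastAtMost)+
  have card_AB: "card A + card B = N"
    using card_Un_disjoint[OF finAB AB(2)] AB(1) by simp
  define j where "j = (\<lambda>v. if v \<in> B then s + 1 else s)"
  have sum_j: "(\<Sum>v\<in>U. j v) = s * card U + card (U \<inter> B)" if "U \<subseteq> {1..N}" for U
  proof -
    have "finite U" using that finite_subset by blast
    moreover have "j = (\<lambda>v. s + (if v \<in> B then 1 else 0))" by (auto simp: j_def)
    ultimately show ?thesis by (simp add: sum.distrib sum.If_cases mult.commute)
  qed
  have card_M: "2 * card M = N * d"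
    using card_perfect_matching[OF fin M] by (simp add: half_edges_def)
  have inner: "card {e \<in> M. config_ends e \<subseteq> U} = inner_edges M (U \<times> {1..d})" for U
    unfolding inner_edges_def using MH
    by (intro arg_cong[where f = card]) (fastforce simp: config_ends_def half_edges_def)
  have "\<exists>P c. k_star_decomposition M config_ends k P c \<and> (\<forall>v\<in>{1..N}. card {S \<in> P. c S = v} = j v)"
  proof (rule ex_star_decomposition)
    show "finite M" using fin M perfect_matchings_finite_member by blast
    show "config_ends e \<subseteq> {1..N}" if "e \<in> M" for e
      using MH[OF that] by (auto simp: config_ends_def half_edges_def)
    have "{1..N} \<inter> B = B" using AB by blast
    then have "2 * (k * (\<Sum>v\<in>{1..N}. j v)) = 2 * card M"
      unfolding card_M using k(3) by (subst sum_j) (auto simp: k(2) algebra_simps)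
    then show "k * (\<Sum>v\<in>{1..N}. j v) = card M" by simp
    fix U assume U: "U \<subseteq> {1..N}"
    then have finU: "finite U" using finite_subset by blast
    show "card {e \<in> M. config_ends e \<subseteq> U} \<le> k * (\<Sum>v\<in>U. j v)"
    proof (cases "card U \<le> card A")
      case True
      with small[OF U] show ?thesis by (simp add: inner sum_j[OF U] algebra_simps)
    next
      case False
      \<comment> \<open>A set U larger than A is handled through its complement, which has fewer
        than \<open>card B\<close> vertices.\<close>
      define W where "W = {1..N} - U"
      have W: "W \<subseteq> {1..N}" "finite W" and card_W: "card W + card U = N"
        using finU U card_mono[OF _ U] by (auto simp: W_def card_Diff_subset)
      have "2 * inner_edges M (W \<times> {1..d}) + 2 * k * card W \<le> (d + r) * card W"
        using False W card_W card_AB by (intro large) auto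
      moreover have "inner_edges M (U \<times> {1..d}) + d * card W = card M + inner_edges M (W \<times> {1..d})"
      proof -
        have "half_edges N d - W \<times> {1..d} = U \<times> {1..d}" "W \<times> {1..d} \<subseteq> half_edges N d"
          using U by (auto simp: half_edges_def W_def)
        then show ?thesis
          using inner_edges_complement[OF fin M, of "W \<times> {1..d}"] by (simp add: card_cartesian_product mult.commute)
      qed
      \<comment> \<open>This is what makes the argument uniform in the partition: whatever B is, at
        most \<open>card W\<close> of its vertices lie outside U.\<close>
      moreover have "card B \<le> card (U \<inter> B) + card W"
      proof -
        have "B \<subseteq> (U \<inter> B) \<union> W" using AB by (auto simp: W_def)
        then have "card B \<le> card ((U \<inter> B) \<union> W)" using finAB W by (intro card_mono) auto
        also have "\<dots> \<le> card (U \<inter> B) + card W" by (rule card_Un_le)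
        finally show ?thesis .
      qed
      then have "k * card B \<le> k * card (U \<inter> B) + k * card W"
        by (metis mult_le_mono2 distrib_left)
      moreover have "2 * card M = 2 * (k * s) * card W + 2 * (k * s) * card U + 2 * k * card B"
        unfolding card_M card_W[symmetric] using k(3)[folded card_W] by (simp add: k(2) algebra_simps)
      moreover have "(d + r) * card W + 2 * (k * s) * card W = 2 * d * card W"
        by (simp add: k(2) algebra_simps)
      ultimately have "inner_edges M (U \<times> {1..d}) \<le> k * s * card U + k * card (U \<inter> B)"
        by (simp add: algebra_simps)
      then show ?thesis by (simp add: inner sum_j[OF U] algebra_simps)
    qed
  qed (use k in auto)
  then obtain P c where P: "k_star_decomposition M config_ends k P c"
    and j: "\<And>v. v \<in> {1..N} \<Longrightarrow> card {S \<in> P. c S = v} = j v" by blast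
  have mem: "v \<in> A \<Longrightarrow> v \<in> {1..N}" "v \<in> B \<Longrightarrow> v \<in> {1..N}" "v \<in> A \<Longrightarrow> v \<notin> B" for v
    using AB by blast+
  have "card {S \<in> P. c S = v} = s" if "v \<in> A" for v
    using j[OF mem(1)[OF that]] mem(3)[OF that] by (simp add: j_def)
  moreover have "card {S \<in> P. c S = v} = s + 1" if "v \<in> B" for v
    using j[OF mem(2)[OF that]] that by (simp add: j_def)
  ultimately show ?thesis using P by blast
qed

section \<open>The union bound\<close>

lemma square_mult_exp_le:
  fixes c y :: real
  assumes "c > 0" "y \<ge> 0"
  shows "y\<^sup>2 * exp (- c * y) \<le> 8 / c\<^sup>2 * exp (- c * y / 2)"
proof -
  \<comment> \<open>Half of the exponential decay is spent on absorbing y^2.\<close>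
  have "(c * y / 2)\<^sup>2 / 2 \<le> exp (c * y / 2)"
    using exp_lower_Taylor_quadratic[of "c * y / 2"] assms by (smt (verit) mult_nonneg_nonneg divide_nonneg_nonneg)
  then have "y\<^sup>2 \<le> 8 / c\<^sup>2 * exp (c * y / 2)"
    using assms by (simp add: field_simps power2_eq_square)
  then have "y\<^sup>2 * exp (- c * y) \<le> 8 / c\<^sup>2 * exp (c * y / 2) * exp (- c * y)"
    by (rule mult_right_mono) simp
  also have "\<dots> = 8 / c\<^sup>2 * exp (- c * y / 2)"
    by (simp add: mult_exp_exp)
  finally show ?thesis .
qed

lemma sum_exp_le:
  fixes c :: real
  assumes "c > 0" "finite S"
  shows "(\<Sum>m\<in>S. exp (- c * real m)) \<le> 1 / (1 - exp (- c))"
proof -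
  have "(\<Sum>m\<in>S. exp (- c) ^ m) \<le> (\<Sum>m. exp (- c) ^ m)"
    using assms by (intro sum_le_suminf summable_geometric) auto
  also have "\<dots> = 1 / (1 - exp (- c))"
    using assms by (intro suminf_geometric) auto
  finally show ?thesis by (simp add: exp_of_nat_mult[symmetric] mult.commute)
qed

text \<open>The event mentions no partition, so one union bound over U serves all partitions at
  once. The empty set is excluded because it always meets the density inequality.\<close>

definition dense_sets :: "nat \<Rightarrow> nat \<Rightarrow> real \<Rightarrow> real \<Rightarrow> (nat \<times> nat) set set set" where
  "dense_sets N d x0 t = {M. \<exists>U. U \<subseteq> {1..N} \<and> U \<noteq> {} \<and> real (card U) \<le> x0 * real N \<and>
     t * real (d * card U) \<le> 2 * real (inner_edges M (U \<times> {1..d}))}"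

lemma not_dense_setsD:
  assumes "M \<notin> dense_sets N d x0 t" "U \<subseteq> {1..N}" "real (card U) \<le> x0 * real N" "U \<noteq> {}"
  shows "2 * real (inner_edges M (U \<times> {1..d})) < t * real (d * card U)"
proof (rule ccontr)
  assume "\<not> 2 * real (inner_edges M (U \<times> {1..d})) < t * real (d * card U)"
  then have "M \<in> dense_sets N d x0 t"
    unfolding dense_sets_def mem_Collect_eq using assms(2-4) by (intro exI[of _ U]) linarith
  with assms(1) show False by simp
qed

lemma prob_inner_edges_le:
  assumes "N > 0" "d > 0" "even (N * d)" "U \<subseteq> {1..N}" "card U = m" "m > 0" "real m / real N \<le> t" "t < 1"
  shows "measure_pmf.prob (configuration_model N d) {M. t * real (d * m) \<le> 2 * real (inner_edges M (U \<times> {1..d}))}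
     \<le> exp 1 * (d * m) * exp (N * (d * rate_F (m / N) t))"
proof -
  let ?H = "half_edges N d"
  have H: "finite ?H" "card ?H = N * d" "U \<times> {1..d} \<subseteq> ?H" "card (U \<times> {1..d}) = d * m"
    using assms(4,5) by (auto simp: half_edges_def card_cartesian_product)
  obtain n where n: "N * d = 2 * n" using assms(3) by blast
  then have nr: "2 * real n = N * d" by (metis of_nat_mult of_nat_numeral)
  have PM: "finite (perfect_matchings ?H)" "perfect_matchings ?H \<noteq> {}"
    using finite_perfect_matchings[OF H(1)] perfect_matchings_nonempty[OF H(1)] H(2) assms(3) by simp_all
  then have pos: "card (perfect_matchings ?H) > 0" by (simp add: card_gt_0_iff)
  have nm: "n > 0" "d * m > 0" using n assms(1,2,6) by (auto intro: Nat.gr0I)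
  \<comment> \<open>The half-edges at U have the same density among all half-edges as U has among
    the vertices.\<close>
  have x: "real m / real N = real (d * m) / (2 * real n)"
    unfolding nr using assms(1,2) by simp
  have expo: "2 * real n * rate_F (m / N) t = N * (d * rate_F (m / N) t)"
    unfolding nr by simp
  have "real (card {M \<in> perfect_matchings ?H. t * real (d * m) \<le> 2 * real (inner_edges M (U \<times> {1..d}))})
    \<le> exp 1 * real (d * m) * exp (2 * real n * rate_F (m / N) t) * card (perfect_matchings ?H)"
    by (rule card_matchings_many_inner_edges[OF H(1) H(2)[unfolded n] nm(1) H(3,4) nm(2) x assms(7,8)])
  moreover have "measure_pmf.prob (configuration_model N d) {M. t * real (d * m) \<le> 2 * real (inner_edges M (U \<times> {1..d}))}
     = card {M \<in> perfect_matchings ?H. t * real (d * m) \<le> 2 * real (inner_edges M (U \<times> {1..d}))} / card (perfect_matchings ?H)"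
    unfolding configuration_model_def using PM
    by (simp add: measure_pmf_of_set Int_def)
  ultimately show ?thesis
    unfolding expo using pos by (simp add: pos_divide_le_eq mult_ac)
qed

lemma prob_dense_sets_le:
  assumes "d \<ge> 3" "0 < x0" "x0 < t" "t < 1" "rate_Fd d x0 t < 0"
  obtains C \<delta> where "\<delta> > 0" "\<And>N. N > 0 \<Longrightarrow> even (N * d) \<Longrightarrow>
    measure_pmf.prob (configuration_model N d) (dense_sets N d x0 t) \<le> C * real N powr - \<delta>"
proof -
  obtain c \<delta> where c: "c > 0" "\<delta> > 0" "\<delta> \<le> 1"
    "\<And>x. 0 < x \<Longrightarrow> x \<le> x0 \<Longrightarrow> rate_Fd d x t \<le> x * (\<delta> * ln x - c)"
    using rate_Fd_le[OF assms] by metis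
  define K where "K = exp 1 * d * (8 / c\<^sup>2)"
  define C where "C = K * (1 / (1 - exp (- (c / 2))))"
  show ?thesis
  proof (rule that)
    fix N :: nat assume N: "N > 0" "even (N * d)"
    define E where "E = (\<lambda>U :: nat set. {M. t * real (d * card U) \<le> 2 * real (inner_edges M (U \<times> {1..d}))})"
    define ms where "ms = {m \<in> {1..N}. m \<le> x0 * N}"
    define Us where "Us = (\<lambda>m. {U. U \<subseteq> {1..N} \<and> card U = m})"
    have finU: "finite (Us m)" for m by (simp add: Us_def)
    let ?p = "measure_pmf.prob (configuration_model N d)"
    have single: "?p (\<Union>U\<in>Us m. E U) \<le> K * N powr - \<delta> * exp (- (c / 2) * m)" if "m \<in> ms" for m
    proof -
      define x where "x = m / N"
      have m: "0 < m" "m \<le> x0 * N" using that by (auto simp: ms_def)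
      have x: "0 < x" "x \<le> x0" using m N by (auto simp: x_def field_simps)
      have "x0 * real N < 1 * real N" using assms(3,4) N by (intro mult_strict_right_mono) auto
      then have "m < N" using m(2) by linarith
      have "?p (\<Union>U\<in>Us m. E U) \<le> (\<Sum>U\<in>Us m. ?p (E U))"
        by (intro measure_pmf.finite_measure_subadditive_finite finU) auto
      also have "\<dots> \<le> (\<Sum>U\<in>Us m. exp 1 * (d * m) * exp (N * (d * rate_F x t)))"
        unfolding E_def x_def
      proof (rule sum_mono, goal_cases)
        case (1 U)
        then show ?case
          using prob_inner_edges_le[of N d U m t] N m assms x by (auto simp: Us_def x_def)
      qed
      also have "\<dots> = (N choose m) * (exp 1 * (d * m) * exp (N * (d * rate_F x t)))"
        using n_subsets[of "{1..N}" m] by (simp add: Us_def)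
      also have "\<dots> \<le> exp (N * ent2 x) * (exp 1 * (d * m) * exp (N * (d * rate_F x t)))"
        using binomial_le_exp_ent2[of m N] m \<open>m < N\<close>
        by (intro mult_right_mono) (auto simp: x_def)
      also have "\<dots> = exp 1 * (d * m) * exp (N * rate_Fd d x t)"
        by (simp add: rate_Fd_def mult_exp_exp algebra_simps)
      also have "\<dots> \<le> exp 1 * (d * m) * (m / N powr \<delta> * exp (- c * m))"
      proof (intro mult_left_mono)
        have "N * rate_Fd d x t \<le> N * (x * (\<delta> * ln x - c))"
          using c(4)[OF x] by (intro mult_left_mono) auto
        also have "\<dots> = m * (\<delta> * ln x) - c * m"
          using N by (simp add: x_def algebra_simps)
        \<comment> \<open>Since m \<ge> 1 and ln x \<le> 0, one of the m factors x^\<delta> can be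
          kept and the others dropped.\<close>
        also have "m * (\<delta> * ln x) \<le> 1 * (\<delta> * ln x)"
          using m x c assms by (intro mult_right_mono_neg) (auto intro: mult_nonneg_nonpos)
        also have "1 * (\<delta> * ln x) = \<delta> * ln m - \<delta> * ln N"
          using m N by (simp add: x_def ln_div algebra_simps)
        \<comment> \<open>Here \<delta> \<le> 1 gives m^\<delta> \<le> m; together with the factor d
          m this produces the m^2 below.\<close>
        also have "\<delta> * ln m \<le> 1 * ln m"
          using m c by (intro mult_right_mono) auto
        finally have "exp (N * rate_Fd d x t) \<le> exp (ln m - \<delta> * ln N - c * m)" by simp
        also have "\<dots> = m / N powr \<delta> * exp (- c * m)"
          using m N by (simp add: exp_diff exp_minus powr_def divide_inverse)
        finally show "exp (N * rate_Fd d x t) \<le> m / N powr \<delta> * exp (- c * m)" .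
      qed auto
      also have "\<dots> = exp 1 * d * N powr - \<delta> * (m\<^sup>2 * exp (- c * m))"
        by (simp add: powr_minus field_simps power2_eq_square)
      also have "\<dots> \<le> exp 1 * d * N powr - \<delta> * (8 / c\<^sup>2 * exp (- c * m / 2))"
        using square_mult_exp_le[OF c(1), of m] by (intro mult_left_mono) auto
      finally show ?thesis by (simp add: K_def mult_ac)
    qed
    have "dense_sets N d x0 t \<subseteq> (\<Union>m\<in>ms. \<Union>U\<in>Us m. E U)"
    proof
      fix M assume "M \<in> dense_sets N d x0 t"
      then obtain U where U: "U \<subseteq> {1..N}" "U \<noteq> {}" "card U \<le> x0 * N" "M \<in> E U"
        by (auto simp: dense_sets_def E_def)
      have "finite U" using U(1) finite_subset by blast
      then have "card U \<in> ms"
        using U card_mono[OF _ U(1)] by (auto simp: ms_def Suc_le_eq card_gt_0_iff)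
      with U show "M \<in> (\<Union>m\<in>ms. \<Union>U\<in>Us m. E U)" by (auto simp: Us_def)
    qed
    then have "?p (dense_sets N d x0 t) \<le> ?p (\<Union>m\<in>ms. \<Union>U\<in>Us m. E U)"
      by (intro measure_pmf.finite_measure_mono) auto
    also have "\<dots> \<le> (\<Sum>m\<in>ms. ?p (\<Union>U\<in>Us m. E U))"
      by (intro measure_pmf.finite_measure_subadditive_finite) (auto simp: ms_def)
    also have "\<dots> \<le> (\<Sum>m\<in>ms. K * N powr - \<delta> * exp (- (c / 2) * m))"
      by (rule sum_mono) (rule single)
    also have "\<dots> = K * N powr - \<delta> * (\<Sum>m\<in>ms. exp (- (c / 2) * m))"
      by (simp only: sum_distrib_left)
    \<comment> \<open>The geometric series bounds the sum over sizes independently of N.\<close>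
    also have "\<dots> \<le> K * N powr - \<delta> * (1 / (1 - exp (- (c / 2))))"
      using c by (intro mult_left_mono sum_exp_le) (auto simp: ms_def K_def)
    finally show "?p (dense_sets N d x0 t) \<le> C * real N powr - \<delta>" by (simp add: C_def mult_ac)
  qed (rule c(2))
qed

section \<open>Assembly from the two density events\<close>

theorem theorem4p1:
  fixes d k s r :: nat and x0 t0 :: real
  assumes "d \<ge> 3" and "k \<ge> 2" and "2 * k \<le> d"
    and "s = nat \<lfloor>real d / (2 * real k)\<rfloor>"
    and "r = d - 2 * s * k"
    and "x0 = real r / (2 * real k)"
    and "t0 = (real d - 2 * real k + real r) / real d"
    and "rate_Fd d x0 t0 < 0"
  shows "((\<lambda>N. measure_pmf.prob (configuration_model N d)
            {M. \<forall>A B :: nat set.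
                  A \<union> B = {1..N} \<and> A \<inter> B = {} \<and>
                  real (card B) = real r * real N / (2 * real k) \<longrightarrow>
                  (\<exists>P c. k_star_decomposition M config_ends k P c \<and>
                    (\<forall>v\<in>A. card {S \<in> P. c S = v} = s) \<and>
                    (\<forall>v\<in>B. card {S \<in> P. c S = v} = s + 1))})
          \<longlongrightarrow> 1)
        (inf sequentially (principal {N. real N * real d / (2 * real k) \<in> \<nat>}))"
    (is "((\<lambda>N. measure_pmf.prob _ (?Good N)) \<longlongrightarrow> 1) _")
proof -
  have s: "s = d div (2 * k)"
    using assms(4) floor_divide_of_nat_eq[of d "2 * k", where 'a = real] by simp
  have r: "r = d mod (2 * k)"
    using minus_div_mult_eq_mod[of d "2 * k"] unfolding assms(5) s by (simp add: mult_ac)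
  have d: "d = 2 * s * k + r"
    using div_mult_mod_eq[of d "2 * k"] unfolding r s by (simp add: mult_ac)
  have r2k: "r < 2 * k" using assms(2) by (simp add: r)
  \<comment> \<open>For r = 0 the hypothesis would fail, as F_d vanishes at x = 0.\<close>
  have "r > 0"
    using assms(8) rate_Fd_0 by (cases "r = 0") (auto simp: assms(6))
  \<comment> \<open>The value s = 0 would give d = r < 2 k; for s \<ge> 1, r > 0 makes the
    inequality strict. Strictness gives \<rho> < 1, hence x0 < t0 and 1 - x0 < t1.\<close>
  have "2 * k < d" using assms(3) d \<open>r > 0\<close> r2k
    by (cases s rule: nat.exhaust) auto
  \<comment> \<open>Here d t1 = 2 k s is twice the number of edges that s stars at a vertex can
    absorb.\<close>
  define t1 where "t1 = (real d - real r) / real d"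
  have x0: "0 < x0" "x0 < 1" using \<open>r > 0\<close> r2k by (auto simp: assms(6))
  define \<rho> where "\<rho> = 2 * real k / real d"
  have "2 * real k < real d" using \<open>2 * k < d\<close> by linarith
  then have \<rho>: "0 < \<rho>" "\<rho> < 1" using assms(2) by (auto simp: \<rho>_def)
  have t0_eq: "t0 = 1 - \<rho> * (1 - x0)" and t1_eq: "t1 = 1 - \<rho> * x0"
    using assms(2,3) by (simp_all add: assms(6,7) t1_def \<rho>_def field_simps)
  have t: "x0 < t0" "t0 < 1" "1 - x0 < t1" "t1 < 1"
  proof -
    have "\<rho> * (1 - x0) < 1 * (1 - x0)" "\<rho> * x0 < 1 * x0"
      using \<rho> x0 by (intro mult_strict_right_mono; simp)+
    moreover have "0 < \<rho> * (1 - x0)" "0 < \<rho> * x0"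
      using \<rho> x0 by (intro mult_pos_pos; simp)+
    ultimately show "x0 < t0" "t0 < 1" "1 - x0 < t1" "t1 < 1"
      unfolding t0_eq t1_eq by simp_all
  qed
  have "t1 * (1 - x0) = 1 - (2 - t0) * x0"
    by (simp add: t0_eq t1_eq algebra_simps)
  then have neg: "rate_Fd d (1 - x0) t1 < 0"
    using rate_Fd_complement[of t1 x0 t0 d] assms(8) by simp
  have "0 < 1 - x0" using x0 by simp
  from prob_dense_sets_le[OF assms(1) this t(3,4) neg] obtain C1 \<delta>1 where b1: "\<delta>1 > 0" "\<And>N. N > 0 \<Longrightarrow> even (N * d) \<Longrightarrow>
    measure_pmf.prob (configuration_model N d) (dense_sets N d (1 - x0) t1) \<le> C1 * real N powr - \<delta>1"
    by blast
  obtain C0 \<delta>0 where b0: "\<delta>0 > 0" "\<And>N. N > 0 \<Longrightarrow> even (N * d) \<Longrightarrow>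
    measure_pmf.prob (configuration_model N d) (dense_sets N d x0 t0) \<le> C0 * real N powr - \<delta>0"
    using prob_dense_sets_le[OF assms(1) x0(1) t(1,2) assms(8)] by blast
  have good: "M \<in> ?Good N"
    if M: "M \<in> perfect_matchings (half_edges N d)" "M \<notin> dense_sets N d (1 - x0) t1" "M \<notin> dense_sets N d x0 t0"
    for M N
  proof (intro CollectI allI impI, elim conjE)
    fix A B :: "nat set"
    assume AB: "A \<union> B = {1..N}" "A \<inter> B = {}" "real (card B) = real r * real N / (2 * real k)"
    have fin: "finite A" "finite B" using AB by (metis finite_Un finite_atLeastAtMost)+
    have "card A + card B = N" using card_Un_disjoint[OF fin AB(2)] AB(1) by simp
    then have "real (card A) + real (card B) = N" by (simp flip: of_nat_add)
    moreover have B: "real (card B) = x0 * N" using AB(3) by (simp add: assms(6))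
    ultimately have A: "real (card A) = (1 - x0) * N" by (simp add: algebra_simps)
    show "\<exists>P c. k_star_decomposition M config_ends k P c \<and>
      (\<forall>v\<in>A. card {S \<in> P. c S = v} = s) \<and> (\<forall>v\<in>B. card {S \<in> P. c S = v} = s + 1)"
    proof (rule ex_star_decomposition_config[OF M(1) AB(1,2) _ d])
      have "real (2 * k * card B) = real (r * N)" using AB(3) assms(2) by simp
      then show "2 * k * card B = r * N" by (simp only: of_nat_eq_iff)
    next
      fix U assume U: "U \<subseteq> {1..N}" "card U \<le> card A"
      have [simp]: "inner_edges M {} = 0" using M(1)
        by (auto simp: inner_edges_def perfect_matchings_def)
      have e: "t1 * real (d * card U) = real (2 * k * s * card U)"
      proof -
        have "real d - real r = 2 * k * s" by (subst d) simp
        then show ?thesis using assms(1) by (simp add: t1_def)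
      qed
      show "inner_edges M (U \<times> {1..d}) \<le> k * s * card U"
      \<comment> \<open>Avoiding \<open>dense_sets\<close> gives no information on the empty set,
        which is treated separately.\<close>
      proof (cases "U = {}")
        case False
        have "2 * real (inner_edges M (U \<times> {1..d})) < t1 * real (d * card U)"
          using U(2) A by (intro not_dense_setsD[OF M(2) U(1) _ False]) simp
        then have "real (2 * inner_edges M (U \<times> {1..d})) < real (2 * k * s * card U)"
          unfolding e by simp
        then show ?thesis unfolding of_nat_less_iff by simp
      qed simp
    next
      fix W assume W: "W \<subseteq> {1..N}" "card W \<le> card B"
      have [simp]: "inner_edges M {} = 0" using M(1)
        by (auto simp: inner_edges_def perfect_matchings_def)
      have e: "t0 * real (d * card W) = (real d - 2 * real k + real r) * real (card W)"
        using assms(1) by (simp add: assms(7))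
      show "2 * inner_edges M (W \<times> {1..d}) + 2 * k * card W \<le> (d + r) * card W"
      proof (cases "W = {}")
        case False
        have "2 * real (inner_edges M (W \<times> {1..d})) < t0 * real (d * card W)"
          using W(2) B by (intro not_dense_setsD[OF M(3) W(1) _ False]) simp
        then have "real (2 * inner_edges M (W \<times> {1..d}) + 2 * k * card W) < real ((d + r) * card W)"
          unfolding e by (simp add: algebra_simps)
        then show ?thesis unfolding of_nat_less_iff by simp
      qed simp
    qed (use assms(2) in simp)
  qed
  have lower: "1 - (C1 * real N powr - \<delta>1 + C0 * real N powr - \<delta>0)
      \<le> measure_pmf.prob (configuration_model N d) (?Good N)"
    if N: "N > 0" "real N * real d / (2 * real k) \<in> \<nat>" for N
  proof -
    let ?p = "measure_pmf.prob (configuration_model N d)"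
    \<comment> \<open>Divisibility of N d by 2 k makes it even, so perfect matchings exist.\<close>
    obtain n where "real N * real d / (2 * real k) = real n" using N(2) by (auto elim: Nats_cases)
    then have "real (N * d) = real (2 * k * n)" using assms(2) by (simp add: field_simps)
    then have "N * d = 2 * k * n" by (simp only: of_nat_eq_iff)
    then have even: "even (N * d)" by simp
    have H: "finite (half_edges N d)" "card (half_edges N d) = N * d" by (simp_all add: half_edges_def)
    have set: "set_pmf (configuration_model N d) = perfect_matchings (half_edges N d)"
      unfolding configuration_model_def
      using perfect_matchings_nonempty[OF H(1)] finite_perfect_matchings[OF H(1)] even H(2)
      by (intro set_pmf_of_set) simp_all
    have "1 = ?p UNIV" using measure_pmf.prob_space[of "configuration_model N d"] by simp
    also have "\<dots> \<le> ?p (?Good N \<union> (dense_sets N d (1 - x0) t1 \<union> dense_sets N d x0 t0))"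
      \<comment> \<open>The inclusion is established for perfect matchings, which carry all the
        mass.\<close>
      by (rule measure_pmf.finite_measure_mono_AE) (use good in \<open>auto simp: AE_measure_pmf_iff set\<close>)
    also have "\<dots> \<le> ?p (?Good N) + ?p (dense_sets N d (1 - x0) t1 \<union> dense_sets N d x0 t0)"
      by (rule measure_Un_le) auto
    also have "?p (dense_sets N d (1 - x0) t1 \<union> dense_sets N d x0 t0)
        \<le> ?p (dense_sets N d (1 - x0) t1) + ?p (dense_sets N d x0 t0)"
      by (rule measure_Un_le) auto
    finally show ?thesis using b1(2)[OF N(1) even] b0(2)[OF N(1) even] by linarith
  qed
  show ?thesis
  proof (rule tendsto_sandwich)
    show "\<forall>\<^sub>F N in inf sequentially (principal {N. real N * real d / (2 * real k) \<in> \<nat>}).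
      1 - (C1 * real N powr - \<delta>1 + C0 * real N powr - \<delta>0)
        \<le> measure_pmf.prob (configuration_model N d) (?Good N)"
      unfolding eventually_inf_principal using eventually_gt_at_top[of 0]
      by eventually_elim (use lower in blast)
    \<comment> \<open>The lower bound converges along all N, and the limit is then restricted to the
      admissible N.\<close>
    have "((\<lambda>N. real N powr - \<delta>) \<longlongrightarrow> 0) sequentially" if "\<delta> > 0" for \<delta> :: real
      using that by (intro tendsto_neg_powr filterlim_real_sequentially) auto
    from tendsto_diff[OF tendsto_const tendsto_add[OF tendsto_mult[OF tendsto_const this[OF b1(1)]]
        tendsto_mult[OF tendsto_const this[OF b0(1)]]], of 1 C1 C0]
    have "((\<lambda>N. 1 - (C1 * real N powr - \<delta>1 + C0 * real N powr - \<delta>0)) \<longlongrightarrow> 1) sequentially"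
      by simp
    then show "((\<lambda>N. 1 - (C1 * real N powr - \<delta>1 + C0 * real N powr - \<delta>0)) \<longlongrightarrow> 1)
      (inf sequentially (principal {N. real N * real d / (2 * real k) \<in> \<nat>}))"
      by (rule tendsto_mono[OF inf_le1])
  qed (auto intro!: always_eventually measure_pmf.prob_le_1)
qed

end
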